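(* Let $\mathbf u:=(x+y^2,y)$, $\mathbf v:=(x,y+x^2)\in\operatorname{Aut}(\mathbb A^2)$, let $U:=\overline{\langle\mathbf u\rangle}$, $V:=\overline{\langle\mathbf v\rangle}$ and $\mathfrak F:=\overline{\langle\mathbf u,\mathbf v\rangle}$ be the closures in $\operatorname{Aut}(\mathbb A^2)$ of the subgroups generated by $\mathbf u$, by $\mathbf v$, and by both, respectively. Let $\mathfrak A:=\{\mathbf g\in\operatorname{Aut}(\mathbb A^2)\mid\mathbf g(0)=0,\ (d\mathbf g)_0=\mathrm{id}\}$ and $S:=\{(\zeta x,\zeta^2y)\mid\zeta\in\Bbbk,\ \zeta^3=1\}$, acting on $\mathfrak A$ by conjugation and on $\operatorname{Lie}\mathfrak A$ by the induced (adjoint) action. Then the Lie algebra $(\operatorname{Lie}\mathfrak A)^S$ is generated by $\operatorname{Lie}U$ and $\operatorname{Lie}V$, hence $\operatorname{Lie}\mathfrak F=\operatorname{Lie}\mathfrak A^S=(\operatorname{Lie}\mathfrak A)^S$.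
   Context: $\Bbbk$ is an algebraically closed field of characteristic zero. An automorphism of $\mathbb A^2$ is written as a pair $(f,h)$ of polynomials in $\Bbbk[x,y]$; its degree is $\max\{\deg f,\deg h\}$. $\operatorname{Aut}(\mathbb A^2)$ is an ind-group, filtered by the affine varieties $\operatorname{Aut}(\mathbb A^2)_d$ of automorphisms $\mathbf g$ with $\deg\mathbf g\le d$ and $\deg\mathbf g^{-1}\le d$; a subset is closed if its intersection with each $\operatorname{Aut}(\mathbb A^2)_d$ is closed. A closed subgroup $\mathfrak H$ is again an ind-group and $\operatorname{Lie}\mathfrak H:=T_e\mathfrak H=\varinjlim T_e(\mathfrak H\cap\operatorname{Aut}(\mathbb A^2)_d)$, with its natural Lie algebra structure. $\mathfrak A$ is a closed subgroup. $\mathfrak A^S$ denotes the closed subgroup of $\mathbf g\in\mathfrak A$ commuting with all $s\in S$, and $(\operatorname{Lie}\mathfrak A)^S$ the $S$-fixed elements of $\operatorname{Lie}\mathfrak A$. Lie algebras of closed subgroups of $\operatorname{Aut}(\mathbb A^2)$ are identified with Lie algebras of vector fields on $\mathbb A^2$ via $A\mapsto\xi_A$, where $\xi_A(p)$ is the image of $A$ under the differential at $e$ of the orbit map $\mathbf g\mapsto\mathbf g(p)$. *)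

theory Defs
  imports
    "HOL-Computational_Algebra.Polynomial"
    "HOL-Library.Poly_Mapping"
    "HOL-Algebra.Generated_Groups"
begin

section \<open>Polynomials in two variables\<close>

text \<open>
  The ring \<open>k[x,y]\<close> is represented as \<open>k[x][y]\<close>: in \<open>'a poly poly\<close> the outer variable is \<open>y\<close>,
  so the coefficient of \<open>x^i y^j\<close> in \<open>p\<close> is \<open>coeff (coeff p j) i\<close>.
\<close>

type_synonym 'a bipoly = "'a poly poly"

definition X2 :: "'a::comm_ring_1 bipoly" where "X2 = [:[:0, 1:]:]"
definition Y2 :: "'a::comm_ring_1 bipoly" where "Y2 = [:0, 1:]"
definition const2 :: "'a::comm_ring_1 \<Rightarrow> 'a bipoly" where "const2 c = [:[:c:]:]"

definition coeff2 :: "'a::comm_ring_1 bipoly \<Rightarrow> nat \<Rightarrow> nat \<Rightarrow> 'a" where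
  "coeff2 p i j = coeff (coeff p j) i"

definition total_degree :: "'a::comm_ring_1 bipoly \<Rightarrow> nat" where
  "total_degree p = Max (insert 0 {i + j | i j. coeff2 p i j \<noteq> 0})"

definition eval2 :: "'a::comm_ring_1 bipoly \<Rightarrow> 'a \<times> 'a \<Rightarrow> 'a" where
  "eval2 p z = poly (poly p [:snd z:]) (fst z)"

definition dX :: "'a::idom bipoly \<Rightarrow> 'a bipoly" where "dX p = map_poly pderiv p"
definition dY :: "'a::idom bipoly \<Rightarrow> 'a bipoly" where "dY p = pderiv p"

text \<open>\<open>subst2 p (f, h)\<close> is the polynomial \<open>p(f, h)\<close>.\<close>

definition subst2 :: "'a::comm_ring_1 bipoly \<Rightarrow> 'a bipoly \<times> 'a bipoly \<Rightarrow> 'a bipoly" where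
  "subst2 p g = poly (map_poly (\<lambda>q. poly (map_poly const2 q) (fst g)) p) (snd g)"


section \<open>The automorphism group of the affine plane\<close>

type_synonym 'a endo = "'a bipoly \<times> 'a bipoly"

definition endo_monoid :: "'a::comm_ring_1 endo monoid" where
  "endo_monoid = \<lparr>carrier = UNIV,
     mult = (\<lambda>g h. (subst2 (fst g) h, subst2 (snd g) h)),
     one = (X2, Y2)\<rparr>"

definition AutA2 :: "'a::comm_ring_1 endo monoid" where
  "AutA2 = units_of endo_monoid"

definition endo_degree :: "'a::comm_ring_1 endo \<Rightarrow> nat" where
  "endo_degree g = max (total_degree (fst g)) (total_degree (snd g))"

definition Aut_deg :: "nat \<Rightarrow> 'a::comm_ring_1 endo set" where
  "Aut_deg d = {g \<in> carrier AutA2. endo_degree g \<le> d \<and> endo_degree (inv\<^bsub>AutA2\<^esub> g) \<le> d}"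


section \<open>The ind-variety structure\<close>

text \<open>
  \<open>Aut_deg d\<close> is an affine variety via the embedding \<open>g \<mapsto> (g, g\<^sup>-\<^sup>1)\<close>, which identifies it with
  the Zariski closed subset \<open>{(g, h). g \<circ> h = h \<circ> g = id}\<close> of the affine space of pairs of
  endomorphisms of degree at most \<open>d\<close>. The coordinates on that space are the coefficients of
  the four polynomials involved: \<open>FwdX i j\<close> and \<open>FwdY i j\<close> are the coefficients of \<open>x^i y^j\<close> in the
  two components of \<open>g\<close>, and \<open>InvX i j\<close>, \<open>InvY i j\<close> those for \<open>g\<^sup>-\<^sup>1\<close>. We do not cut the set of
  coordinates down to \<open>i + j \<le> d\<close>: the other ones vanish identically on \<open>Aut_deg d\<close>,
  which changes neither its closed subsets nor their tangent spaces.
\<close>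

datatype coord = FwdX nat nat | FwdY nat nat | InvX nat nat | InvY nat nat

primrec coord_of :: "'a::comm_ring_1 endo \<times> 'a endo \<Rightarrow> coord \<Rightarrow> 'a" where
  "coord_of w (FwdX i j) = coeff2 (fst (fst w)) i j"
| "coord_of w (FwdY i j) = coeff2 (snd (fst w)) i j"
| "coord_of w (InvX i j) = coeff2 (fst (snd w)) i j"
| "coord_of w (InvY i j) = coeff2 (snd (snd w)) i j"

text \<open>
  Polynomials in the coordinates are finitely supported maps from exponent vectors to scalars.
  \<open>cp_diff P c w\<close> is the differential of \<open>P\<close> at \<open>c\<close> in direction \<open>w\<close>, i.e. the coefficient
  of \<open>t\<close> in \<open>P(c + t w)\<close>.
\<close>

type_synonym 'a coord_poly = "(coord \<Rightarrow>\<^sub>0 nat) \<Rightarrow>\<^sub>0 'a"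

definition cp_eval :: "'a::comm_ring_1 coord_poly \<Rightarrow> (coord \<Rightarrow> 'a) \<Rightarrow> 'a" where
  "cp_eval P c = (\<Sum>m\<in>Poly_Mapping.keys P. Poly_Mapping.lookup P m *
     (\<Prod>i\<in>Poly_Mapping.keys m. c i ^ Poly_Mapping.lookup m i))"

definition cp_diff :: "'a::comm_ring_1 coord_poly \<Rightarrow> (coord \<Rightarrow> 'a) \<Rightarrow> (coord \<Rightarrow> 'a) \<Rightarrow> 'a" where
  "cp_diff P c w = coeff (\<Sum>m\<in>Poly_Mapping.keys P. smult (Poly_Mapping.lookup P m)
     (\<Prod>i\<in>Poly_Mapping.keys m. [:c i, w i:] ^ Poly_Mapping.lookup m i)) 1"

definition aut_coords :: "'a::comm_ring_1 endo \<Rightarrow> coord \<Rightarrow> 'a" where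
  "aut_coords g = coord_of (g, inv\<^bsub>AutA2\<^esub> g)"

definition zariski_closed_in_deg :: "nat \<Rightarrow> 'a::comm_ring_1 endo set \<Rightarrow> bool" where
  "zariski_closed_in_deg d Z \<longleftrightarrow>
     (\<exists>M. Z = {g \<in> Aut_deg d. \<forall>P\<in>M. cp_eval P (aut_coords g) = 0})"

definition ind_closed :: "'a::comm_ring_1 endo set \<Rightarrow> bool" where
  "ind_closed Z \<longleftrightarrow> Z \<subseteq> carrier AutA2 \<and> (\<forall>d. zariski_closed_in_deg d (Z \<inter> Aut_deg d))"

definition closure_of_generated :: "'a::comm_ring_1 endo set \<Rightarrow> 'a endo set" where
  "closure_of_generated G = ind_closed hull (generate AutA2 G)"


section \<open>Lie algebras of subgroups, as vector fields\<close>

text \<open>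
  The Zariski tangent space at the identity of \<open>Z \<subseteq> Aut_deg d\<close>: the common kernel of the
  differentials at the identity of all polynomials vanishing on \<open>Z\<close>. Its elements are pairs
  \<open>(A, B)\<close>, where \<open>A\<close> is the direction for \<open>g\<close> and \<open>B\<close> the direction for \<open>g\<^sup>-\<^sup>1\<close>.
\<close>

definition tangent_id :: "'a::comm_ring_1 endo set \<Rightarrow> ('a endo \<times> 'a endo) set" where
  "tangent_id Z = {w. \<forall>P. (\<forall>g\<in>Z. cp_eval P (aut_coords g) = 0) \<longrightarrow>
     cp_diff P (aut_coords \<one>\<^bsub>AutA2\<^esub>) (coord_of w) = 0}"

text \<open>
  A pair \<open>(a, b)\<close> also stands for the vector field \<open>a \<partial>/\<partial>x + b \<partial>/\<partial>y\<close>.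
  For a point \<open>p\<close> the orbit map \<open>g \<mapsto> g(p)\<close> is linear in the coefficients of \<open>g\<close>, so its
  differential sends the tangent vector \<open>(A, B)\<close> to \<open>A(p)\<close>; hence the vector field of
  \<open>(A, B)\<close> is \<open>A\<close>.
\<close>

type_synonym 'a vfield = "'a bipoly \<times> 'a bipoly"

definition Lie :: "'a::comm_ring_1 endo set \<Rightarrow> 'a vfield set" where
  "Lie H = (\<Union>d. fst ` tangent_id (H \<inter> Aut_deg d))"

text \<open>
  The bracket is that of derivations, \<open>[\<xi>, \<eta>] = \<xi> \<circ> \<eta> - \<eta> \<circ> \<xi>\<close>. Under the identification with
  \<open>T\<^sub>e\<close> it agrees with the bracket of the ind-group up to the usual global sign, which does
  not affect the subalgebras.
\<close>

definition vf_apply :: "'a::idom vfield \<Rightarrow> 'a bipoly \<Rightarrow> 'a bipoly" where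
  "vf_apply \<xi> f = fst \<xi> * dX f + snd \<xi> * dY f"

definition vf_bracket :: "'a::idom vfield \<Rightarrow> 'a vfield \<Rightarrow> 'a vfield" where
  "vf_bracket \<xi> \<eta> = (vf_apply \<xi> (fst \<eta>) - vf_apply \<eta> (fst \<xi>),
                    vf_apply \<xi> (snd \<eta>) - vf_apply \<eta> (snd \<xi>))"

definition lie_subalgebra :: "'a::idom vfield set \<Rightarrow> bool" where
  "lie_subalgebra L \<longleftrightarrow>
     (0, 0) \<in> L \<and>
     (\<forall>\<xi>\<in>L. \<forall>\<eta>\<in>L. (fst \<xi> + fst \<eta>, snd \<xi> + snd \<eta>) \<in> L) \<and>
     (\<forall>c. \<forall>\<xi>\<in>L. (const2 c * fst \<xi>, const2 c * snd \<xi>) \<in> L) \<and>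
     (\<forall>\<xi>\<in>L. \<forall>\<eta>\<in>L. vf_bracket \<xi> \<eta> \<in> L)"

definition lie_generated :: "'a::idom vfield set \<Rightarrow> 'a vfield set" where
  "lie_generated T = lie_subalgebra hull T"

text \<open>
  The differential at the identity of \<open>g \<mapsto> s \<circ> g \<circ> s\<^sup>-\<^sup>1\<close>, expressed on vector fields: expanding
  \<open>s \<circ> (id + t \<xi>) \<circ> s\<^sup>-\<^sup>1\<close> to first order in \<open>t\<close> gives the push-forward \<open>(ds \<cdot> \<xi>) \<circ> s\<^sup>-\<^sup>1\<close>.
\<close>

definition Ad :: "'a::idom endo \<Rightarrow> 'a vfield \<Rightarrow> 'a vfield" where
  "Ad s \<xi> = (subst2 (vf_apply \<xi> (fst s)) (inv\<^bsub>AutA2\<^esub> s),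
            subst2 (vf_apply \<xi> (snd s)) (inv\<^bsub>AutA2\<^esub> s))"

definition group_fixed :: "'a::comm_ring_1 endo set \<Rightarrow> 'a endo set \<Rightarrow> 'a endo set" where
  "group_fixed H S = {g \<in> H. \<forall>s\<in>S. g \<otimes>\<^bsub>AutA2\<^esub> s = s \<otimes>\<^bsub>AutA2\<^esub> g}"

definition lie_fixed :: "'a::idom vfield set \<Rightarrow> 'a endo set \<Rightarrow> 'a vfield set" where
  "lie_fixed L S = {\<xi> \<in> L. \<forall>s\<in>S. Ad s \<xi> = \<xi>}"

text \<open>Automorphisms fixing the origin, with identity differential (Jacobian matrix) there.\<close>

definition Aut_tangent_to_id :: "'a::idom endo set" where
  "Aut_tangent_to_id = {g \<in> carrier AutA2.
     eval2 (fst g) (0, 0) = 0 \<and> eval2 (snd g) (0, 0) = 0 \<and>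
     eval2 (dX (fst g)) (0, 0) = 1 \<and> eval2 (dY (fst g)) (0, 0) = 0 \<and>
     eval2 (dX (snd g)) (0, 0) = 0 \<and> eval2 (dY (snd g)) (0, 0) = 1}"

end

theory Submission
  imports Defs
begin

text \<open>
  All Lie algebras in the theorem are equal to one explicit algebra \<open>W\<close> of Hamiltonian vector fields,
  which is contained in the smallest and contains the largest of them.

  \<^item> Upper bound. An automorphism has constant Jacobian determinant, so elements of \<open>Lie A\<close> have
    divergence zero (\<open>Lie_Aut_tangent_to_id_divergence\<close>); they also vanish to order at least two at the origin. A polynomial
    field of divergence zero is \<open>H\<^sub>y \<partial>/\<partial>x - H\<^sub>x \<partial>/\<partial>y\<close> for a polynomial \<open>H\<close>. Invariance under
    \<open>S\<close>, tested with a primitive cube root of unity, restricts the monomials \<open>x\<^sup>i y\<^sup>j\<close> of \<open>H\<close> to those with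
    \<open>i + 2 j\<close> divisible by 3, and the order of vanishing to those with \<open>i + j \<ge> 3\<close>. Let \<open>W\<close> be the algebra
    of the fields with such an \<open>H\<close>; then the fixed part of \<open>Lie A\<close> lies in \<open>W\<close>
    (\<open>graded_Lie_Aut_tangent_to_id\<close>).

  \<^item> Generation. Up to scalars, bracketing with \<open>y\<^sup>2 \<partial>/\<partial>x\<close> replaces \<open>x\<close> by \<open>y\<^sup>2\<close> in a monomial Hamiltonian, bracketing with
    \<open>x\<^sup>2 \<partial>/\<partial>y\<close> replaces \<open>y\<close> by \<open>x\<^sup>2\<close>. Starting from \<open>x\<^sup>3\<close> and \<open>y\<^sup>3\<close>, the Hamiltonians of the two generators,
    up to scalars, this reaches every admissible monomial (\<open>ham_generated\<close>). So \<open>W\<close> lies in each subspace that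
    contains the two generators and is stable under the brackets with them.

  \<^item> Lower bound. \<open>Lie F\<close> is such a subspace. It contains \<open>y\<^sup>2 \<partial>/\<partial>x\<close>, since the powers
    \<open>(x + n y\<^sup>2, y)\<close> of \<open>u\<close> are Zariski dense on a line through the identity. The closed set \<open>F\<close> is stable
    under conjugation by these powers, so \<open>Lie F\<close> is stable under their adjoint action, which is
    polynomial in \<open>n\<close> with the bracket as its linear coefficient; hence \<open>Lie F\<close> is
    stable under the bracket (\<open>Lie_bracket_shear_field\<close>). The same holds for \<open>v\<close>.

  The inclusions \<open>W \<subseteq> Lie F \<subseteq> Lie A\<^sup>S \<subseteq> (Lie A)\<^sup>S \<subseteq> W\<close> follow; the second one holds because \<open>A\<^sup>S\<close> is closed
  and contains \<open>u\<close> and \<open>v\<close>. The Lie algebra generated by \<open>Lie U\<close> and \<open>Lie V\<close> contains \<open>W\<close> by the second point,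
  and is contained in it because \<open>W\<close> is closed under the Poisson bracket.

  Computations with the Zariski tangent space use no explicit formula for the differential of a
  coordinate polynomial. A polynomial is restricted to a curve that depends polynomially on a parameter, and
  the linear coefficient of the result is compared with the first-order part of the curve
  (\<open>cp_diff_curve\<close>); the calculus for such curves is that of the predicate \<open>jet\<close>.
\<close>

section \<open>The polynomial ring in two variables\<close>

text \<open>
  Both sides of the identities for substitution and differentiation below are determined by their
  behaviour on constants, on \<open>x\<close>, on \<open>y\<close> and under sums and products, so this rule reduces each
  of them to a handful of trivial cases.
\<close>

lemma bipoly_induct [case_names const X Y add mult]:
  fixes p :: "'a::comm_ring_1 bipoly"
  assumes "\<And>c. P (const2 c)" "P X2" "P Y2"
    and add: "\<And>p q. P p \<Longrightarrow> P q \<Longrightarrow> P (p + q)" and mult: "\<And>p q. P p \<Longrightarrow> P q \<Longrightarrow> P (p * q)"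
  shows "P p"
proof -
  have base: "P [:a:]" for a :: "'a poly"
  proof (induction a)
    case 0
    show ?case using assms(1)[of 0] by (simp add: const2_def)
  next
    case (pCons c a)
    have "[:pCons c a:] = const2 c + X2 * [:a:]"
      by (simp add: const2_def X2_def)
    then show ?case using pCons assms by metis
  qed
  show ?thesis
  proof (induction p)
    case 0
    show ?case using base[of 0] by simp
  next
    case (pCons a p)
    have "pCons a p = [:a:] + Y2 * p"
      by (simp add: Y2_def)
    then show ?case using pCons base assms by metis
  qed
qed

lemma const2_simps [simp]:
  "const2 (0::'a::comm_ring_1) = 0" "const2 (1::'a) = 1"
  by (simp_all add: const2_def one_pCons)

lemma const2_add: "const2 (a + b) = const2 a + const2 (b::'a::comm_ring_1)"
  by (simp add: const2_def)
lemma const2_mult: "const2 (a * b) = const2 a * const2 (b::'a::comm_ring_1)"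
  by (simp add: const2_def)
lemma const2_minus: "const2 (- a) = - const2 (a::'a::comm_ring_1)"
  by (simp add: const2_def)
lemma const2_power: "const2 (a ^ n) = const2 (a::'a::comm_ring_1) ^ n"
  by (induction n) (simp_all add: const2_mult)

lemma coeff2_simps [simp]:
  "coeff2 (p + q) i j = coeff2 p i j + coeff2 q i j"
  "coeff2 (p - q) i j = coeff2 p i j - coeff2 q i j"
  "coeff2 (- p) i j = - coeff2 p i j"
  "coeff2 0 i j = 0"
  "coeff2 (const2 c * p) i j = c * coeff2 p i j"
  "coeff2 (sum f M) i j = (\<Sum>m\<in>M. coeff2 (f m) i j)"
  by (simp_all add: coeff2_def const2_def coeff_sum)

lemma coeff2_const2: "coeff2 (const2 c) i j = (if i = 0 \<and> j = 0 then c else 0)"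
  by (simp add: coeff2_def const2_def coeff_pCons split: nat.split)

lemma bipoly_eqI: "(\<And>i j. coeff2 p i j = coeff2 q i j) \<Longrightarrow> p = q"
  by (simp add: coeff2_def poly_eq_iff)

lemma bipoly_eq_iff: "p = q \<longleftrightarrow> (\<forall>i j. coeff2 p i j = coeff2 q i j)"
  using bipoly_eqI by blast

lemma coeff2_monom: "coeff2 (X2 ^ a * Y2 ^ b :: 'a::comm_ring_1 bipoly) i j = (if i = a \<and> j = b then 1 else 0)"
proof -
  have Y: "Y2 ^ b = (monom 1 b :: 'a bipoly)"
    by (simp add: Y2_def monom_altdef)
  have X: "X2 ^ a = ([:monom 1 a:] :: 'a bipoly)"
    by (induction a) (simp_all add: X2_def monom_Suc one_pCons)
  show ?thesis
    unfolding X Y coeff2_def by (auto simp: smult_monom)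
qed

lemma coeff2_mult:
  "coeff2 (p * q) i j = (\<Sum>k\<le>j. \<Sum>l\<le>i. coeff2 p l k * coeff2 q (i - l) (j - k))"
  by (simp add: coeff2_def coeff_mult coeff_sum)

lemma coeff2_mult_nonzeroE:
  assumes "coeff2 (p * q) i j \<noteq> 0"
  obtains i1 j1 i2 j2 where "i = i1 + i2" "j = j1 + j2" "coeff2 p i1 j1 \<noteq> 0" "coeff2 q i2 j2 \<noteq> 0"
proof -
  obtain k l where kl: "k \<le> j" "l \<le> i" "coeff2 p l k * coeff2 q (i - l) (j - k) \<noteq> 0"
    using assms unfolding coeff2_mult by (meson atMost_iff sum.not_neutral_contains_not_neutral)
  then have "coeff2 p l k \<noteq> 0" "coeff2 q (i - l) (j - k) \<noteq> 0" by auto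
  then show ?thesis using kl that[of l "i - l" k "j - k"] by simp
qed

text \<open>
  A bound on the total degree, rather than the degree itself, is stable under sums whether or not
  leading terms cancel.
\<close>

definition deg_le :: "nat \<Rightarrow> 'a::comm_ring_1 bipoly \<Rightarrow> bool" where
  "deg_le d p \<longleftrightarrow> (\<forall>i j. coeff2 p i j \<noteq> 0 \<longrightarrow> i + j \<le> d)"

lemma finite_support2: "finite {(i, j). coeff2 p i j \<noteq> 0}"
proof (rule finite_subset)
  show "{(i, j). coeff2 p i j \<noteq> 0} \<subseteq> (\<Union>j\<le>degree p. {..degree (coeff p j)} \<times> {j})"
    by (auto simp: coeff2_def intro!: le_degree)
qed auto

lemma deg_le_total_degree: "total_degree p \<le> d \<longleftrightarrow> deg_le d p"
proof -
  have "{i + j | i j. coeff2 p i j \<noteq> 0} = (\<lambda>(i, j). i + j) ` {(i, j). coeff2 p i j \<noteq> 0}"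
    by auto
  then have "finite {i + j | i j. coeff2 p i j \<noteq> 0}"
    using finite_support2[of p] by simp
  then show ?thesis by (auto simp: total_degree_def deg_le_def)
qed

lemma deg_le_exists: "\<exists>d. deg_le d p"
  using deg_le_total_degree by blast

lemma deg_le_mono: "deg_le d p \<Longrightarrow> d \<le> e \<Longrightarrow> deg_le e p"
  unfolding deg_le_def using le_trans by blast

lemma deg_le_intros:
  "deg_le d p \<Longrightarrow> deg_le d q \<Longrightarrow> deg_le d (p + q)"
  "deg_le d p \<Longrightarrow> deg_le d (const2 c * p)"
  "deg_le d (0::'a::comm_ring_1 bipoly)"
  "deg_le d (const2 c)"
  by (auto simp: deg_le_def coeff2_const2 split: if_splits) (metis add_0 mult_zero_right)+

lemma deg_le_sum: "(\<And>m. m \<in> M \<Longrightarrow> deg_le d (f m)) \<Longrightarrow> deg_le d (sum f M)"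
  by (induction M rule: infinite_finite_induct) (auto intro: deg_le_intros)

lemma deg_le_mult: "deg_le d p \<Longrightarrow> deg_le e q \<Longrightarrow> deg_le (d + e) (p * q)"
  unfolding deg_le_def
proof (intro allI impI)
  fix i j
  assume *: "\<forall>i j. coeff2 p i j \<noteq> 0 \<longrightarrow> i + j \<le> d" "\<forall>i j. coeff2 q i j \<noteq> 0 \<longrightarrow> i + j \<le> e"
    and "coeff2 (p * q) i j \<noteq> 0"
  from this(3) obtain i1 j1 i2 j2 where "i = i1 + i2" "j = j1 + j2" "coeff2 p i1 j1 \<noteq> 0" "coeff2 q i2 j2 \<noteq> 0"
    by (rule coeff2_mult_nonzeroE)
  then show "i + j \<le> d + e"
    using *(1)[rule_format, of i1 j1] *(2)[rule_format, of i2 j2] by linarith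
qed

lemma deg_le_power: "deg_le d p \<Longrightarrow> deg_le (n * d) (p ^ n)"
proof (induction n)
  case 0
  show ?case using deg_le_intros(4)[of 0 1] by simp
next
  case (Suc n)
  then show ?case using deg_le_mult[of d p "n * d" "p ^ n"] by simp
qed

lemma deg_le_X2: "deg_le 1 (X2 :: 'a::comm_ring_1 bipoly)"
  and deg_le_Y2: "deg_le 1 (Y2 :: 'a::comm_ring_1 bipoly)"
  using coeff2_monom[of 1 0, where 'a='a] coeff2_monom[of 0 1, where 'a='a]
  by (auto simp: deg_le_def split: if_splits)

lemma coeff2_sum_monom:
  assumes "finite M"
  shows "coeff2 (\<Sum>(i, j)\<in>M. const2 (c i j) * (X2 ^ i * Y2 ^ j)) a b = (if (a, b) \<in> M then c a b else 0)"
proof -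
  have "coeff2 (\<Sum>(i, j)\<in>M. const2 (c i j) * (X2 ^ i * Y2 ^ j)) a b
      = (\<Sum>m\<in>M. if m = (a, b) then c a b else 0)"
    by (auto simp: coeff2_monom intro!: sum.cong)
  then show ?thesis
    using assms by simp
qed

lemma finite_bounded_degree: "finite {(i, j). i + j \<le> (d :: nat)}"
  by (rule finite_subset[of _ "{..d} \<times> {..d}"]) auto

lemma bipoly_expansion:
  assumes "deg_le d p"
  shows "p = (\<Sum>(i, j)\<in>{(i, j). i + j \<le> d}. const2 (coeff2 p i j) * (X2 ^ i * Y2 ^ j))"
  using assms by (intro bipoly_eqI) (auto simp: coeff2_sum_monom[OF finite_bounded_degree] deg_le_def simp del: coeff2_simps)

section \<open>Substitution and evaluation\<close>

text \<open>
  Substitution evaluates a polynomial twice after mapping its coefficients: the inner layer along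
  \<open>const2\<close>, the outer one along the inner evaluation. Both maps are ring homomorphisms, so one
  lemma serves for both layers.
\<close>

lemma poly_map_poly_hom:
  fixes f :: "'b::comm_ring_1 \<Rightarrow> 'c::comm_ring_1"
  assumes "f 0 = 0" "f 1 = 1" "\<And>a b. f (a + b) = f a + f b" "\<And>a b. f (a * b) = f a * f b"
  shows "poly (map_poly f (p + q)) x = poly (map_poly f p) x + poly (map_poly f q) x"
    and "poly (map_poly f (p * q)) x = poly (map_poly f p) x * poly (map_poly f q) x"
proof -
  have pc: "poly (map_poly f (pCons a p)) x = f a + x * poly (map_poly f p) x" for a p
    using assms(1) by (cases "a = 0 \<and> p = 0") (auto simp: map_poly_pCons)
  have add: "poly (map_poly f (p + q)) x = poly (map_poly f p) x + poly (map_poly f q) x" for p q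
    by (induction p q rule: poly_induct2) (simp_all add: pc assms algebra_simps)
  have smult: "poly (map_poly f (smult a q)) x = f a * poly (map_poly f q) x" for a q
    by (induction q) (simp_all add: pc assms algebra_simps)
  show "poly (map_poly f (p + q)) x = poly (map_poly f p) x + poly (map_poly f q) x"
    by (fact add)
  show "poly (map_poly f (p * q)) x = poly (map_poly f p) x * poly (map_poly f q) x"
    by (induction p) (simp_all add: pc add smult assms algebra_simps)
qed

lemma subst2_add: "subst2 (p + q) g = subst2 p g + subst2 q g"
  and subst2_mult: "subst2 (p * q) g = subst2 p g * subst2 q g"
  unfolding subst2_def
  by (intro poly_map_poly_hom; simp add: poly_map_poly_hom const2_add const2_mult map_poly_1 flip: one_pCons)+

lemma subst2_const2 [simp]: "subst2 (const2 c) g = const2 c"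
  by (cases "c = 0") (simp_all add: subst2_def const2_def map_poly_pCons)
lemma subst2_X2 [simp]: "subst2 X2 g = fst g"
  by (simp add: subst2_def X2_def map_poly_pCons)
lemma subst2_Y2 [simp]: "subst2 Y2 g = snd g"
  by (simp add: subst2_def Y2_def map_poly_pCons flip: one_pCons)

lemma subst2_0 [simp]: "subst2 0 g = 0" and subst2_1 [simp]: "subst2 1 g = 1"
  using subst2_const2[of 0 g] subst2_const2[of 1 g] by simp_all
lemma subst2_power: "subst2 (p ^ n) g = subst2 p g ^ n"
  by (induction n) (simp_all add: subst2_mult)
lemma subst2_minus: "subst2 (- p) g = - subst2 p g"
  using subst2_add[of p "- p" g] by (simp add: minus_unique)
lemma subst2_diff: "subst2 (p - q) g = subst2 p g - subst2 q g"
  using subst2_add[of p "- q" g] by (simp add: subst2_minus)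
lemma subst2_sum: "subst2 (sum f M) g = (\<Sum>m\<in>M. subst2 (f m) g)"
  by (induction M rule: infinite_finite_induct) (simp_all add: subst2_add)

lemmas subst2_simps = subst2_add subst2_mult subst2_power subst2_minus subst2_diff

lemma subst2_id: "subst2 p (X2, Y2) = p"
  by (induction p rule: bipoly_induct) (simp_all add: subst2_simps)

lemma subst2_assoc: "subst2 (subst2 p g) h = subst2 p (subst2 (fst g) h, subst2 (snd g) h)"
  by (induction p rule: bipoly_induct) (simp_all add: subst2_simps)

text \<open>
  For a fixed degree bound, substitution into \<open>p\<close> is linear in the finitely many coefficients of \<open>p\<close>;
  this is why composition is a polynomial operation on coordinates.
\<close>

lemma subst2_expansion:
  assumes "deg_le d p"
  shows "subst2 p g = (\<Sum>(i, j)\<in>{(i, j). i + j \<le> d}. const2 (coeff2 p i j) * (fst g ^ i * snd g ^ j))"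
  by (subst (1) bipoly_expansion[OF assms])
     (simp add: subst2_sum subst2_simps case_prod_unfold)

lemma deg_le_subst2:
  assumes "deg_le d p" "deg_le e (fst g)" "deg_le e (snd g)"
  shows "deg_le (d * e) (subst2 p g)"
  unfolding subst2_expansion[OF assms(1)]
proof (intro deg_le_sum, clarify)
  fix i j assume "i + j \<le> d"
  then have "deg_le (d * e) (fst g ^ i * snd g ^ j)"
    using deg_le_mult[OF deg_le_power[OF assms(2)] deg_le_power[OF assms(3)], of i j]
    by (elim deg_le_mono) (simp flip: add_mult_distrib)
  then show "deg_le (d * e) (const2 (coeff2 p i j) * (fst g ^ i * snd g ^ j))"
    by (rule deg_le_intros)
qed

lemma eval2_simps [simp]:
  "eval2 (p + q) z = eval2 p z + eval2 q z" "eval2 (p * q) z = eval2 p z * eval2 q z"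
  "eval2 (const2 c) z = c" "eval2 X2 z = fst z" "eval2 Y2 z = snd z"
  by (simp_all add: eval2_def const2_def X2_def Y2_def)

lemma eval2_subst2: "eval2 (subst2 p g) z = eval2 p (eval2 (fst g) z, eval2 (snd g) z)"
  by (induction p rule: bipoly_induct) (simp_all add: subst2_simps)

lemma eval2_origin: "eval2 p (0, 0) = coeff2 p 0 0"
  by (simp add: eval2_def coeff2_def poly_0_coeff_0)

section \<open>Partial derivatives\<close>

lemma coeff2_dX: "coeff2 (dX p) i j = of_nat (Suc i) * coeff2 p (Suc i) j"
  by (simp add: coeff2_def dX_def coeff_map_poly coeff_pderiv)
lemma coeff2_dY: "coeff2 (dY p) i j = of_nat (Suc j) * coeff2 p i (Suc j)"
  by (simp add: coeff2_def dY_def coeff_pderiv of_nat_poly)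

lemma dX_pCons: "dX (pCons a p) = pCons (pderiv a) (dX p)"
  by (cases "a = 0 \<and> p = 0") (auto simp: dX_def map_poly_pCons)

lemma dX_simps [simp]:
  "dX (p + q) = dX p + dX q" "dX (p - q) = dX p - dX q" "dX (- p) = - dX p" "dX 0 = 0"
  "dX (const2 c) = 0" "dX X2 = 1" "dX Y2 = 0" "dX 1 = 0"
proof -
  show "dX (p + q) = dX p + dX q" "dX (p - q) = dX p - dX q" "dX (- p) = - dX p"
    by (rule bipoly_eqI, simp add: coeff2_dX algebra_simps)+
  show "dX 0 = 0"
    by (rule bipoly_eqI) (simp add: coeff2_dX)
  then show "dX (const2 c) = 0" "dX X2 = 1" "dX Y2 = 0" "dX 1 = 0"
    by (simp_all add: dX_pCons const2_def X2_def Y2_def pderiv_pCons one_pCons)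
qed

lemma dY_simps [simp]:
  "dY (p + q) = dY p + dY q" "dY (p - q) = dY p - dY q" "dY (- p) = - dY p" "dY 0 = 0"
  "dY (const2 c) = 0" "dY X2 = 0" "dY Y2 = 1" "dY 1 = 0"
  by (simp_all add: dY_def pderiv_add pderiv_diff pderiv_minus const2_def X2_def Y2_def pderiv_pCons)

lemma dX_mult: "dX (p * q) = dX p * q + p * dX q"
proof (induction p)
  case (pCons a p)
  have sm: "dX (smult a q) = smult (pderiv a) q + smult a (dX q)" for q
    by (rule poly_eqI) (simp add: dX_def coeff_map_poly pderiv_mult algebra_simps)
  show ?case
    using pCons by (simp add: dX_pCons sm algebra_simps)
qed simp

lemma dY_mult: "dY (p * q) = dY p * q + p * dY q"
  by (simp add: dY_def pderiv_mult algebra_simps)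

lemma dX_monom: "dX (X2 ^ a * Y2 ^ b :: 'a::idom bipoly) = const2 (of_nat a) * (X2 ^ (a - 1) * Y2 ^ b)"
  and dY_monom: "dY (X2 ^ a * Y2 ^ b :: 'a::idom bipoly) = const2 (of_nat b) * (X2 ^ a * Y2 ^ (b - 1))"
proof -
  show "dX (X2 ^ a * Y2 ^ b :: 'a bipoly) = const2 (of_nat a) * (X2 ^ (a - 1) * Y2 ^ b)"
    by (rule bipoly_eqI) (cases a; auto simp: coeff2_dX coeff2_monom simp del: power_Suc power_0)
  show "dY (X2 ^ a * Y2 ^ b :: 'a bipoly) = const2 (of_nat b) * (X2 ^ a * Y2 ^ (b - 1))"
    by (rule bipoly_eqI) (cases b; auto simp: coeff2_dY coeff2_monom simp del: power_Suc power_0)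
qed

lemma dX_dY_commute: "dX (dY p) = dY (dX p)"
  by (rule bipoly_eqI) (simp add: coeff2_dX coeff2_dY algebra_simps)

section \<open>Regular functions on pairs of endomorphisms\<close>

definition mon_eval :: "(coord \<Rightarrow>\<^sub>0 nat) \<Rightarrow> (coord \<Rightarrow> 'a::comm_ring_1) \<Rightarrow> 'a" where
  "mon_eval m c = (\<Prod>i\<in>Poly_Mapping.keys m. c i ^ Poly_Mapping.lookup m i)"

lemma mon_eval_superset:
  assumes "finite K" "Poly_Mapping.keys m \<subseteq> K"
  shows "mon_eval m c = (\<Prod>i\<in>K. c i ^ Poly_Mapping.lookup m i)"
  unfolding mon_eval_def
  by (rule prod.mono_neutral_left) (use assms in \<open>auto simp: in_keys_iff\<close>)

lemma mon_eval_add: "mon_eval (m + n) c = mon_eval m c * mon_eval n c"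
proof -
  define K where "K = Poly_Mapping.keys m \<union> Poly_Mapping.keys n"
  have K: "finite K" "Poly_Mapping.keys m \<subseteq> K" "Poly_Mapping.keys n \<subseteq> K" "Poly_Mapping.keys (m + n) \<subseteq> K"
    using keys_add[of m n] by (auto simp: K_def)
  show ?thesis
    unfolding K(2-)[THEN mon_eval_superset[OF K(1)]]
    by (simp add: lookup_add power_add prod.distrib)
qed

lemma cp_eval_superset:
  assumes "finite K" "Poly_Mapping.keys P \<subseteq> K"
  shows "cp_eval P c = (\<Sum>m\<in>K. Poly_Mapping.lookup P m * mon_eval m c)"
  unfolding cp_eval_def mon_eval_def[symmetric]
  by (rule sum.mono_neutral_left) (use assms in \<open>auto simp: in_keys_iff\<close>)

lemma cp_eval_add: "cp_eval (P + Q) c = cp_eval P c + cp_eval Q c"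
proof -
  define K where "K = Poly_Mapping.keys P \<union> Poly_Mapping.keys Q"
  have K: "finite K" "Poly_Mapping.keys P \<subseteq> K" "Poly_Mapping.keys Q \<subseteq> K" "Poly_Mapping.keys (P + Q) \<subseteq> K"
    using keys_add[of P Q] by (auto simp: K_def)
  show ?thesis
    unfolding K(2-)[THEN cp_eval_superset[OF K(1)]]
    by (simp add: lookup_add sum.distrib algebra_simps)
qed

lemma cp_eval_single: "cp_eval (Poly_Mapping.single m a) c = a * mon_eval m c"
  by (subst cp_eval_superset[of "{m}"]) auto

lemma cp_eval_zero [simp]: "cp_eval 0 c = 0"
  by (simp add: cp_eval_def)

text \<open>
  A polynomial is a sum of monomials; multiplicativity of evaluation is checked on these.
\<close>

lemma poly_mapping_induct [case_names zero single sum]: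
  fixes f :: "'b \<Rightarrow>\<^sub>0 'c::comm_monoid_add"
  assumes "P 0" "\<And>k v. P (Poly_Mapping.single k v)" "\<And>f g. P f \<Longrightarrow> P g \<Longrightarrow> P (f + g)"
  shows "P f"
proof (induction f rule: update_induct)
  case (update f a b)
  have "Poly_Mapping.update a b f = f + Poly_Mapping.single a b"
    using update(1) by (intro poly_mapping_eqI) (auto simp: lookup_update lookup_add lookup_single in_keys_iff when_def)
  then show ?case using update assms by simp
qed (rule assms)

lemma cp_eval_mult: "cp_eval (P * Q) c = cp_eval P c * cp_eval Q c"
proof (induction P rule: poly_mapping_induct)
  case (single m a)
  show ?case
  proof (induction Q rule: poly_mapping_induct)
    case (single n b)
    show ?case by (simp add: cp_eval_single mult_single mon_eval_add algebra_simps)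
  qed (simp_all add: cp_eval_add algebra_simps)
qed (simp_all add: cp_eval_add algebra_simps)

definition pair_deg_le :: "nat \<Rightarrow> 'a::comm_ring_1 endo \<times> 'a endo \<Rightarrow> bool" where
  "pair_deg_le d w \<longleftrightarrow> deg_le d (fst (fst w)) \<and> deg_le d (snd (fst w)) \<and>
     deg_le d (fst (snd w)) \<and> deg_le d (snd (snd w))"

text \<open>
  The functions that are given by a coordinate polynomial on all pairs of bounded degree. The bound keeps
  the number of coordinates finite, without which composition would not be polynomial. The domain
  consists of arbitrary pairs of endomorphisms instead of pairs \<open>(g, g\<^sup>-\<^sup>1)\<close>, because the
  functions have to be restricted to lines \<open>id + t w\<close>, which leave the group.
\<close>

definition regular :: "nat \<Rightarrow> ('a::comm_ring_1 endo \<times> 'a endo \<Rightarrow> 'a) \<Rightarrow> bool" where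
  "regular d f \<longleftrightarrow> (\<exists>P. \<forall>w. pair_deg_le d w \<longrightarrow> cp_eval P (coord_of w) = f w)"

lemma regular_const [intro]: "regular d (\<lambda>_. a)"
  unfolding regular_def
  by (rule exI[of _ "Poly_Mapping.single 0 a"]) (simp add: cp_eval_single mon_eval_def)

lemma regular_coord: "regular d (\<lambda>w. coord_of w k)"
  unfolding regular_def
  by (rule exI[of _ "Poly_Mapping.single (Poly_Mapping.single k 1) 1"])
     (simp add: cp_eval_single mon_eval_def)

lemma regular_add [intro]: "regular d f \<Longrightarrow> regular d g \<Longrightarrow> regular d (\<lambda>w. f w + g w)"
  unfolding regular_def by (metis cp_eval_add)

lemma regular_mult [intro]: "regular d f \<Longrightarrow> regular d g \<Longrightarrow> regular d (\<lambda>w. f w * g w)"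
  unfolding regular_def by (metis cp_eval_mult)

lemma regular_diff [intro]: "regular d f \<Longrightarrow> regular d g \<Longrightarrow> regular d (\<lambda>w. f w - g w)"
  using regular_add[OF _ regular_mult[OF regular_const[of d "- 1"]], of f g] by simp

lemma regular_sum [intro]: "(\<And>m. m \<in> M \<Longrightarrow> regular d (f m)) \<Longrightarrow> regular d (\<lambda>w. \<Sum>m\<in>M. f m w)"
  by (induction M rule: infinite_finite_induct) auto

lemma regular_prod [intro]: "(\<And>m. m \<in> M \<Longrightarrow> regular d (f m)) \<Longrightarrow> regular d (\<lambda>w. \<Prod>m\<in>M. f m w)"
  by (induction M rule: infinite_finite_induct) auto

lemma regular_power [intro]: "regular d f \<Longrightarrow> regular d (\<lambda>w. f w ^ n)"
  by (induction n) auto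

lemma regular_compose:
  assumes "\<And>k. regular d (\<lambda>w. coord_of (\<phi> w) k)"
  shows "regular d (\<lambda>w. cp_eval P (coord_of (\<phi> w)))"
  unfolding cp_eval_def by (intro regular_sum regular_mult regular_const regular_prod regular_power assms)

text \<open>
  Morphisms into the space of bivariate polynomials, one coefficient at a time. Products stay regular
  because each coefficient of a product is a finite sum of products of coefficients.
\<close>

definition poly_regular :: "nat \<Rightarrow> ('a::comm_ring_1 endo \<times> 'a endo \<Rightarrow> 'a bipoly) \<Rightarrow> bool" where
  "poly_regular d f \<longleftrightarrow> (\<forall>i j. regular d (\<lambda>w. coeff2 (f w) i j))"

lemma poly_regular_const [intro]: "poly_regular d (\<lambda>_. p)"
  by (auto simp: poly_regular_def)
lemma poly_regular_add [intro]: "poly_regular d f \<Longrightarrow> poly_regular d g \<Longrightarrow> poly_regular d (\<lambda>w. f w + g w)"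
  by (auto simp: poly_regular_def)
lemma poly_regular_diff [intro]: "poly_regular d f \<Longrightarrow> poly_regular d g \<Longrightarrow> poly_regular d (\<lambda>w. f w - g w)"
  by (auto simp: poly_regular_def)
lemma poly_regular_mult [intro]: "poly_regular d f \<Longrightarrow> poly_regular d g \<Longrightarrow> poly_regular d (\<lambda>w. f w * g w)"
  unfolding poly_regular_def coeff2_mult by (intro allI regular_sum regular_mult) auto
lemma poly_regular_sum [intro]: "(\<And>m. m \<in> M \<Longrightarrow> poly_regular d (f m)) \<Longrightarrow> poly_regular d (\<lambda>w. \<Sum>m\<in>M. f m w)"
  by (induction M rule: infinite_finite_induct) auto
lemma poly_regular_dX [intro]: "poly_regular d f \<Longrightarrow> poly_regular d (\<lambda>w. dX (f w))"
  by (auto simp: poly_regular_def coeff2_dX)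
lemma poly_regular_dY [intro]: "poly_regular d f \<Longrightarrow> poly_regular d (\<lambda>w. dY (f w))"
  by (auto simp: poly_regular_def coeff2_dY)

lemma poly_regular_component [intro]:
  "poly_regular d (\<lambda>w. fst (fst w))" "poly_regular d (\<lambda>w. snd (fst w))"
  "poly_regular d (\<lambda>w. fst (snd w))" "poly_regular d (\<lambda>w. snd (snd w))"
  unfolding poly_regular_def
  by (auto intro: regular_coord simp flip: coord_of.simps)

lemma regular_cong:
  "(\<And>w. pair_deg_le d w \<Longrightarrow> f w = g w) \<Longrightarrow> regular d f \<longleftrightarrow> regular d g"
  by (simp add: regular_def)

lemma poly_regular_cong:
  assumes "poly_regular d f" "\<And>w. pair_deg_le d w \<Longrightarrow> f w = g w"
  shows "poly_regular d g"
  unfolding poly_regular_def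
proof (intro allI)
  fix i j
  have "regular d (\<lambda>w. coeff2 (f w) i j)"
    using assms(1) by (simp add: poly_regular_def)
  then show "regular d (\<lambda>w. coeff2 (g w) i j)"
    using regular_cong[of d "\<lambda>w. coeff2 (f w) i j" "\<lambda>w. coeff2 (g w) i j"] assms(2) by simp
qed

lemma poly_regular_const2 [intro]: "regular d f \<Longrightarrow> poly_regular d (\<lambda>w. const2 (f w))"
  unfolding poly_regular_def
proof (intro allI)
  fix i j
  assume "regular d f"
  then show "regular d (\<lambda>w. coeff2 (const2 (f w)) i j)"
    by (cases "i = 0 \<and> j = 0") (auto simp: coeff2_const2)
qed

lemma poly_regular_subst2 [intro]:
  assumes "poly_regular d f" "\<And>w. pair_deg_le d w \<Longrightarrow> deg_le d (f w)"
  shows "poly_regular d (\<lambda>w. subst2 (f w) g)"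
proof -
  have "poly_regular d (\<lambda>w. \<Sum>(i, j)\<in>{(i, j). i + j \<le> d}. const2 (coeff2 (f w) i j) * (fst g ^ i * snd g ^ j))"
    unfolding case_prod_unfold using assms(1)
    by (intro poly_regular_sum poly_regular_mult poly_regular_const2 poly_regular_const) (simp add: poly_regular_def)
  moreover have "(\<Sum>(i, j)\<in>{(i, j). i + j \<le> d}. const2 (coeff2 (f w) i j) * (fst g ^ i * snd g ^ j)) = subst2 (f w) g"
    if "pair_deg_le d w" for w
    using subst2_expansion[OF assms(2)[OF that]] by simp
  ultimately show ?thesis
    by (rule poly_regular_cong)
qed

section \<open>Differentials of coordinate polynomials\<close>

text \<open>
  The value of \<open>P\<close> at a point with coordinates in \<open>k[t]\<close>, that is, along a polynomial curve.
\<close>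

definition cp_evalp :: "'a::comm_ring_1 coord_poly \<Rightarrow> (coord \<Rightarrow> 'a poly) \<Rightarrow> 'a poly" where
  "cp_evalp P c = (\<Sum>m\<in>Poly_Mapping.keys P. smult (Poly_Mapping.lookup P m)
     (\<Prod>i\<in>Poly_Mapping.keys m. c i ^ Poly_Mapping.lookup m i))"

lemma poly_cp_evalp: "poly (cp_evalp P c) t = cp_eval P (\<lambda>k. poly (c k) t)"
  by (simp add: cp_evalp_def cp_eval_def poly_sum poly_prod poly_power)

lemma cp_diff_eq_cp_evalp: "cp_diff P e w = coeff (cp_evalp P (\<lambda>k. [:e k, w k:])) 1"
  by (simp add: cp_diff_def cp_evalp_def)

definition eq_mod_t2 :: "'a::comm_ring_1 poly \<Rightarrow> 'a poly \<Rightarrow> bool" where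
  "eq_mod_t2 p q \<longleftrightarrow> coeff p 0 = coeff q 0 \<and> coeff p 1 = coeff q 1"

lemma eq_mod_t2_mult: "eq_mod_t2 p q \<Longrightarrow> eq_mod_t2 p' q' \<Longrightarrow> eq_mod_t2 (p * p') (q * q')"
  by (simp add: eq_mod_t2_def coeff_mult)

lemma eq_mod_t2_power: "eq_mod_t2 p q \<Longrightarrow> eq_mod_t2 (p ^ n) (q ^ n)"
  by (induction n) (auto intro: eq_mod_t2_mult simp: eq_mod_t2_def[of 1])

lemma eq_mod_t2_prod: "(\<And>i. eq_mod_t2 (f i) (g i)) \<Longrightarrow> eq_mod_t2 (prod f M) (prod g M)"
  by (induction M rule: infinite_finite_induct) (auto intro: eq_mod_t2_mult simp: eq_mod_t2_def[of 1])

text \<open>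
  The differential sees only the first-order part of a curve: congruence modulo \<open>t\<^sup>2\<close> is
  preserved by products, so the curve may be replaced by its tangent line. The polynomial \<open>q\<close> enters
  through its values alone, since a polynomial over an infinite field is determined by them.
\<close>

lemma cp_diff_curve:
  fixes P :: "'a::field_char_0 coord_poly"
  assumes "\<And>t. poly q t = cp_eval P (\<lambda>k. poly (c k) t)"
    and "\<And>k. coeff (c k) 0 = e k" "\<And>k. coeff (c k) 1 = w k"
  shows "cp_diff P e w = coeff q 1"
proof -
  have "q = cp_evalp P c"
    using assms(1) by (intro poly_ext) (simp add: poly_cp_evalp)
  moreover have "eq_mod_t2 (\<Prod>i\<in>Poly_Mapping.keys m. c i ^ Poly_Mapping.lookup m i)
    (\<Prod>i\<in>Poly_Mapping.keys m. [:e i, w i:] ^ Poly_Mapping.lookup m i)" for m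
    by (intro eq_mod_t2_prod eq_mod_t2_power) (use assms(2,3) in \<open>simp add: eq_mod_t2_def\<close>)
  ultimately show ?thesis
    unfolding cp_diff_eq_cp_evalp cp_evalp_def by (simp add: eq_mod_t2_def coeff_sum)
qed

text \<open>
  Linear forms that involve finitely many coordinates. Differentials have this shape, which is stronger
  than linearity: it lets them be applied coefficientwise to families that depend polynomially on a
  parameter.
\<close>

definition linform :: "((coord \<Rightarrow> 'a::comm_ring_1) \<Rightarrow> 'a) \<Rightarrow> bool" where
  "linform f \<longleftrightarrow> (\<exists>K D. finite K \<and> (\<forall>w. f w = (\<Sum>k\<in>K. D k * w k)))"

lemma linform_0: "linform (\<lambda>_. 0)"
  unfolding linform_def by (rule exI[of _ "{}"]) simp

lemma linform_coord: "linform (\<lambda>w. a * w k)"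
  unfolding linform_def by (rule exI[of _ "{k}"]) auto

lemma linform_add:
  assumes "linform f" "linform g"
  shows "linform (\<lambda>w. f w + g w)"
proof -
  obtain K D K' D' where *: "finite K" "\<And>w. f w = (\<Sum>k\<in>K. D k * w k)" "finite K'" "\<And>w. g w = (\<Sum>k\<in>K'. D' k * w k)"
    using assms unfolding linform_def by auto
  have "f w + g w = (\<Sum>k\<in>K \<union> K'. ((if k \<in> K then D k else 0) + (if k \<in> K' then D' k else 0)) * w k)" for w
  proof -
    have "f w = (\<Sum>k\<in>K \<union> K'. (if k \<in> K then D k else 0) * w k)"
      unfolding * by (rule sum.mono_neutral_cong_left) (use * in auto)
    moreover have "g w = (\<Sum>k\<in>K \<union> K'. (if k \<in> K' then D' k else 0) * w k)"
      unfolding * by (rule sum.mono_neutral_cong_left) (use * in auto)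
    ultimately show ?thesis by (simp add: sum.distrib algebra_simps)
  qed
  then show ?thesis
    unfolding linform_def
    by (intro exI[of _ "K \<union> K'"] exI[of _ "\<lambda>k. (if k \<in> K then D k else 0) + (if k \<in> K' then D' k else 0)"])
       (simp add: *)
qed

lemma linform_scale:
  assumes "linform f"
  shows "linform (\<lambda>w. a * f w)"
proof -
  obtain K D where "finite K" "\<And>w. f w = (\<Sum>k\<in>K. D k * w k)"
    using assms unfolding linform_def by auto
  then show ?thesis
    unfolding linform_def
    by (intro exI[of _ K] exI[of _ "\<lambda>k. a * D k"]) (simp add: sum_distrib_left mult.assoc)
qed

lemma linform_sum: "(\<And>m. m \<in> M \<Longrightarrow> linform (f m)) \<Longrightarrow> linform (\<lambda>w. \<Sum>m\<in>M. f m w)"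
  by (induction M rule: infinite_finite_induct) (auto intro: linform_0 linform_add)

lemma coeff1_mult: "coeff (p * q) 1 = coeff p 0 * coeff q 1 + coeff q 0 * coeff p 1" for p q :: "'a::comm_ring_1 poly"
  by (simp add: coeff_mult mult.commute)

lemma coeff_0_prod: "coeff (prod f K) 0 = (\<Prod>k\<in>K. coeff (f k) 0)" for f :: "'b \<Rightarrow> 'a::comm_ring_1 poly"
  by (induction K rule: infinite_finite_induct) (simp_all add: coeff_mult_0)

lemma linform_cp_diff: "linform (cp_diff P e)" for e :: "coord \<Rightarrow> 'a::comm_ring_1"
proof -
  have pow: "linform (\<lambda>w. coeff ([:e k, w k:] ^ n) 1)" for k n
  proof (induction n)
    case (Suc n)
    show ?case
      unfolding power_Suc coeff1_mult
      using linform_add[OF linform_scale[OF Suc, of "e k"] linform_coord[of "e k ^ n" k]]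
      by (simp add: coeff_0_power)
  qed (simp add: linform_0)
  have pr: "linform (\<lambda>w. coeff (\<Prod>k\<in>K. [:e k, w k:] ^ n k) 1)" if "finite K" for K and n :: "coord \<Rightarrow> nat"
    using that
  proof (induction K)
    case (insert k K)
    show ?case
      unfolding prod.insert[OF insert.hyps] coeff1_mult
      using linform_add[OF linform_scale[OF insert.IH, of "e k ^ n k"] linform_scale[OF pow, of "\<Prod>k\<in>K. e k ^ n k" k "n k"]]
      by (simp add: coeff_0_power coeff_0_prod)
  qed (simp add: linform_0)
  show ?thesis
    unfolding cp_diff_def coeff_sum coeff_smult
    by (intro linform_sum linform_scale pr) simp
qed

lemma linform_poly:
  assumes "linform f"
  shows "\<exists>q. (\<forall>t. poly q t = f (\<lambda>k. poly (c k) t)) \<and> (\<forall>n. coeff q n = f (\<lambda>k. coeff (c k) n))"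
proof -
  obtain K D where *: "finite K" "\<And>w. f w = (\<Sum>k\<in>K. D k * w k)"
    using assms unfolding linform_def by auto
  show ?thesis
    by (rule exI[of _ "\<Sum>k\<in>K. smult (D k) (c k)"]) (simp add: * poly_sum coeff_sum)
qed

lemma linform_linear:
  assumes "linform f"
  shows "f (\<lambda>k. w k + w' k) = f w + f w'" "f (\<lambda>k. a * w k) = a * f w" "f (\<lambda>k. 0) = 0"
  using assms unfolding linform_def by (auto simp: sum.distrib sum_distrib_left algebra_simps)

section \<open>First-order jets of polynomial families\<close>

text \<open>
  The family \<open>\<phi>\<close> of bivariate polynomials depends polynomially on a parameter \<open>t\<close> and equals
  \<open>p + t q\<close> up to terms of order two. The polynomial dependence is witnessed by a polynomial whose
  coefficients lie in \<open>k[x,y]\<close>. The parameter is the position on a tangent line in some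
  applications and the time of a one-parameter group in others.
\<close>

definition jet :: "('a::comm_ring_1 \<Rightarrow> 'a bipoly) \<Rightarrow> 'a bipoly \<Rightarrow> 'a bipoly \<Rightarrow> bool" where
  "jet \<phi> p q \<longleftrightarrow> (\<exists>G. (\<forall>t. \<phi> t = poly G (const2 t)) \<and> coeff G 0 = p \<and> coeff G 1 = q)"

lemma jetI: "(\<And>t. \<phi> t = poly G (const2 t)) \<Longrightarrow> coeff G 0 = p \<Longrightarrow> coeff G 1 = q \<Longrightarrow> jet \<phi> p q"
  unfolding jet_def by blast

lemma jet_const: "jet (\<lambda>_. p) p 0"
  by (rule jetI[of _ "[:p:]"]) simp_all

lemma jet_line: "jet (\<lambda>t. p + const2 t * q) p q"
  by (rule jetI[of _ "[:p, q:]"]) simp_all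

lemma jet_param: "jet (\<lambda>t. const2 t * q) 0 q"
  using jet_line[of 0 q] by simp

lemma jet_add:
  assumes "jet \<phi> p q" "jet \<psi> p' q'"
  shows "jet (\<lambda>t. \<phi> t + \<psi> t) (p + p') (q + q')"
proof -
  obtain G where G: "\<And>t. \<phi> t = poly G (const2 t)" "coeff G 0 = p" "coeff G 1 = q"
    using assms(1) unfolding jet_def by blast
  obtain H where H: "\<And>t. \<psi> t = poly H (const2 t)" "coeff H 0 = p'" "coeff H 1 = q'"
    using assms(2) unfolding jet_def by blast
  show ?thesis
    by (rule jetI[of _ "G + H"]) (use G H in simp_all)
qed

lemma jet_mult:
  assumes "jet \<phi> p q" "jet \<psi> p' q'"
  shows "jet (\<lambda>t. \<phi> t * \<psi> t) (p * p') (p * q' + q * p')"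
proof -
  obtain G where G: "\<And>t. \<phi> t = poly G (const2 t)" "coeff G 0 = p" "coeff G 1 = q"
    using assms(1) unfolding jet_def by blast
  obtain H where H: "\<And>t. \<psi> t = poly H (const2 t)" "coeff H 0 = p'" "coeff H 1 = q'"
    using assms(2) unfolding jet_def by blast
  show ?thesis
    by (rule jetI[of _ "G * H"]) (use G H in \<open>simp_all add: coeff_mult\<close>)
qed

lemma jet_diff:
  assumes "jet \<phi> p q" "jet \<psi> p' q'"
  shows "jet (\<lambda>t. \<phi> t - \<psi> t) (p - p') (q - q')"
proof -
  obtain G where G: "\<And>t. \<phi> t = poly G (const2 t)" "coeff G 0 = p" "coeff G 1 = q"
    using assms(1) unfolding jet_def by blast
  obtain H where H: "\<And>t. \<psi> t = poly H (const2 t)" "coeff H 0 = p'" "coeff H 1 = q'"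
    using assms(2) unfolding jet_def by blast
  show ?thesis
    by (rule jetI[of _ "G - H"]) (use G H in simp_all)
qed

text \<open>
  A map that is linear over the constants acts on a family coefficient by coefficient. This covers the
  partial derivatives and the substitution of a fixed endomorphism.
\<close>

lemma jet_linear:
  assumes "\<And>p q. L (p + q) = L p + L q" "\<And>c p. L (const2 c * p) = const2 c * L p"
    and "jet \<phi> p q"
  shows "jet (\<lambda>t. L (\<phi> t)) (L p) (L q)"
proof -
  obtain G where G: "\<And>t. \<phi> t = poly G (const2 t)" "coeff G 0 = p" "coeff G 1 = q"
    using assms(3) unfolding jet_def by blast
  have L0: "L 0 = 0"
    using assms(2)[of 0 0] by simp
  have "L (poly G (const2 t)) = poly (map_poly L G) (const2 t)" for t
  proof (induction G)
    case (pCons a G)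
    then show ?case
      by (cases "a = 0 \<and> G = 0") (auto simp: assms L0 map_poly_pCons)
  qed (simp add: L0)
  then show ?thesis
    by (intro jetI[of _ "map_poly L G"]) (use G in \<open>simp_all add: L0 coeff_map_poly\<close>)
qed

lemma jet_dX: "jet \<phi> p q \<Longrightarrow> jet (\<lambda>t. dX (\<phi> t)) (dX p) (dX q)"
  by (rule jet_linear) (simp_all add: dX_mult)

lemma jet_dY: "jet \<phi> p q \<Longrightarrow> jet (\<lambda>t. dY (\<phi> t)) (dY p) (dY q)"
  by (rule jet_linear) (simp_all add: dY_mult)

lemma jet_subst2_right: "jet \<phi> p q \<Longrightarrow> jet (\<lambda>t. subst2 (\<phi> t) g) (subst2 p g) (subst2 q g)"
  by (rule jet_linear) (simp_all add: subst2_simps)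

text \<open>
  The chain rule for substituting a moving endomorphism.
\<close>

lemma jet_subst2_left:
  assumes "jet \<phi> a1 b1" "jet \<psi> a2 b2"
  shows "jet (\<lambda>t. subst2 p (\<phi> t, \<psi> t)) (subst2 p (a1, a2))
    (b1 * subst2 (dX p) (a1, a2) + b2 * subst2 (dY p) (a1, a2))"
proof (induction p rule: bipoly_induct)
  case (add p q)
  show ?case
    using jet_add[OF add] by (simp add: subst2_simps algebra_simps)
next
  case (mult p q)
  show ?case
    using jet_mult[OF mult] by (simp add: subst2_simps dX_mult dY_mult algebra_simps)
qed (use assms in \<open>simp_all add: jet_const\<close>)

lemma jet_coeff2:
  assumes "jet \<phi> p q"
  shows "\<exists>c. (\<forall>t. poly c t = coeff2 (\<phi> t) i j) \<and> coeff c 0 = coeff2 p i j \<and> coeff c 1 = coeff2 q i j"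
proof -
  obtain G where G: "\<And>t. \<phi> t = poly G (const2 t)" "coeff G 0 = p" "coeff G 1 = q"
    using assms(1) unfolding jet_def by blast
  have "poly (map_poly (\<lambda>p. coeff2 p i j) G) t = coeff2 (poly G (const2 t)) i j" for t
  proof (induction G)
    case (pCons a G)
    then show ?case
      by (cases "a = 0 \<and> G = 0") (auto simp: map_poly_pCons)
  qed simp
  then show ?thesis
    by (intro exI[of _ "map_poly (\<lambda>p. coeff2 p i j) G"]) (use G in \<open>simp add: coeff_map_poly\<close>)
qed

definition pair_jet :: "('a::comm_ring_1 \<Rightarrow> 'a endo \<times> 'a endo) \<Rightarrow> 'a endo \<times> 'a endo \<Rightarrow> 'a endo \<times> 'a endo \<Rightarrow> bool" where
  "pair_jet \<phi> e w \<longleftrightarrow>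
     jet (\<lambda>t. fst (fst (\<phi> t))) (fst (fst e)) (fst (fst w)) \<and>
     jet (\<lambda>t. snd (fst (\<phi> t))) (snd (fst e)) (snd (fst w)) \<and>
     jet (\<lambda>t. fst (snd (\<phi> t))) (fst (snd e)) (fst (snd w)) \<and>
     jet (\<lambda>t. snd (snd (\<phi> t))) (snd (snd e)) (snd (snd w))"

lemma pair_jet_coords:
  assumes "pair_jet \<phi> e w"
  shows "\<exists>c. \<forall>k. (\<forall>t. poly (c k) t = coord_of (\<phi> t) k) \<and>
    coeff (c k) 0 = coord_of e k \<and> coeff (c k) 1 = coord_of w k"
proof (rule choice, rule allI)
  fix k
  show "\<exists>c. (\<forall>t. poly c t = coord_of (\<phi> t) k) \<and> coeff c 0 = coord_of e k \<and> coeff c 1 = coord_of w k"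
    using assms by (cases k) (auto simp: pair_jet_def simp del: One_nat_def intro: jet_coeff2)
qed

lemma cp_eval_along_jet:
  fixes P :: "'a::field_char_0 coord_poly"
  assumes "pair_jet \<phi> e w"
  shows "\<exists>q. (\<forall>t. poly q t = cp_eval P (coord_of (\<phi> t))) \<and>
    coeff q 1 = cp_diff P (coord_of e) (coord_of w)"
proof -
  obtain c where c: "\<forall>k. (\<forall>t. poly (c k) t = coord_of (\<phi> t) k) \<and>
    coeff (c k) 0 = coord_of e k \<and> coeff (c k) 1 = coord_of w k"
    using pair_jet_coords[OF assms] by (rule exE)
  have "poly (cp_evalp P c) t = cp_eval P (coord_of (\<phi> t))" for t
    using c by (simp add: poly_cp_evalp)
  moreover have "cp_diff P (coord_of e) (coord_of w) = coeff (cp_evalp P c) 1"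
    by (rule cp_diff_curve[OF poly_cp_evalp]) (use c in blast)+
  ultimately show ?thesis
    by (intro exI[of _ "cp_evalp P c"]) simp
qed

text \<open>
  With a differential for \<open>f\<close>, this turns the statement that every member of a family of vectors is
  tangent into the same statement for its derivative.
\<close>

lemma linform_along_jet:
  assumes "pair_jet \<phi> e w" "linform f"
  shows "\<exists>q. (\<forall>t. poly q t = f (coord_of (\<phi> t))) \<and> coeff q 1 = f (coord_of w)"
proof -
  obtain c where c: "\<forall>k. (\<forall>t. poly (c k) t = coord_of (\<phi> t) k) \<and>
    coeff (c k) 0 = coord_of e k \<and> coeff (c k) 1 = coord_of w k"
    using pair_jet_coords[OF assms(1)] by (rule exE)
  obtain q where "\<forall>t. poly q t = f (\<lambda>k. poly (c k) t)" "\<forall>n. coeff q n = f (\<lambda>k. coeff (c k) n)"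
    using linform_poly[OF assms(2), of c] by blast
  then show ?thesis
    using c by (intro exI[of _ q]) (simp del: One_nat_def)
qed

section \<open>The automorphism group and its filtration\<close>

lemma monoid_endo: "Group.monoid (endo_monoid :: 'a::comm_ring_1 endo monoid)"
  by (rule monoidI) (auto simp: endo_monoid_def subst2_assoc subst2_id)

lemma group_AutA2: "group (AutA2 :: 'a::comm_ring_1 endo monoid)"
  unfolding AutA2_def by (rule monoid.units_group[OF monoid_endo])

lemma AutA2_mult [simp]: "g \<otimes>\<^bsub>AutA2\<^esub> h = (subst2 (fst g) h, subst2 (snd g) h)"
  by (simp add: AutA2_def units_of_def endo_monoid_def)

lemma AutA2_one [simp]: "\<one>\<^bsub>AutA2\<^esub> = (X2, Y2)"
  by (simp add: AutA2_def units_of_def endo_monoid_def)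

lemma AutA2_inverseI:
  fixes g h :: "'a::comm_ring_1 endo"
  assumes "g \<otimes>\<^bsub>AutA2\<^esub> h = \<one>\<^bsub>AutA2\<^esub>" "h \<otimes>\<^bsub>AutA2\<^esub> g = \<one>\<^bsub>AutA2\<^esub>"
  shows "g \<in> carrier AutA2" "inv\<^bsub>AutA2\<^esub> g = h"
proof -
  have "a \<in> carrier AutA2" if "a \<otimes>\<^bsub>AutA2\<^esub> b = \<one>\<^bsub>AutA2\<^esub>" "b \<otimes>\<^bsub>AutA2\<^esub> a = \<one>\<^bsub>AutA2\<^esub>" for a b :: "'a endo"
  proof -
    have "a \<in> Units endo_monoid"
      unfolding Units_def using that
      by (intro CollectI conjI bexI[of _ b]) (simp_all add: endo_monoid_def)
    then show ?thesis by (simp add: AutA2_def units_of_def)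
  qed
  then have "g \<in> carrier AutA2" "h \<in> carrier AutA2"
    using assms by blast+
  then show "g \<in> carrier AutA2" "inv\<^bsub>AutA2\<^esub> g = h"
    using group.inv_equality[OF group_AutA2 assms(2)] by auto
qed

lemma Aut_deg_iff: "g \<in> Aut_deg d \<longleftrightarrow> g \<in> carrier AutA2 \<and> pair_deg_le d (g, inv\<^bsub>AutA2\<^esub> g)"
  by (auto simp: Aut_deg_def endo_degree_def pair_deg_le_def deg_le_total_degree)

lemma Aut_deg_mono: "d \<le> e \<Longrightarrow> Aut_deg d \<subseteq> Aut_deg e"
  by (auto simp: Aut_deg_def)

definition id_pair :: "'a::comm_ring_1 endo \<times> 'a endo" where
  "id_pair = ((X2, Y2), (X2, Y2))"

lemma aut_coords_one: "aut_coords (\<one>\<^bsub>AutA2\<^esub> :: 'a::comm_ring_1 endo) = coord_of id_pair"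
  using AutA2_inverseI(2)[of "(X2, Y2) :: 'a endo" "(X2, Y2)"]
  unfolding aut_coords_def id_pair_def by simp

definition line :: "'a::comm_ring_1 endo \<times> 'a endo \<Rightarrow> 'a \<Rightarrow> 'a endo \<times> 'a endo" where
  "line w t = ((X2 + const2 t * fst (fst w), Y2 + const2 t * snd (fst w)),
               (X2 + const2 t * fst (snd w), Y2 + const2 t * snd (snd w)))"

lemma pair_jet_line: "pair_jet (line w) id_pair w"
  by (simp add: pair_jet_def line_def id_pair_def jet_line)

lemma pair_deg_le_line:
  assumes "pair_deg_le d w" "1 \<le> d"
  shows "pair_deg_le d (line w t)"
  using assms deg_le_mono[OF deg_le_X2] deg_le_mono[OF deg_le_Y2]
  by (auto simp: pair_deg_le_def line_def intro!: deg_le_intros)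

section \<open>Tangent spaces at the identity\<close>

lemma tangent_id_iff: "w \<in> tangent_id Z \<longleftrightarrow>
  (\<forall>P. (\<forall>g\<in>Z. cp_eval P (coord_of (g, inv\<^bsub>AutA2\<^esub> g)) = 0) \<longrightarrow> cp_diff P (coord_of id_pair) (coord_of w) = 0)"
  unfolding tangent_id_def aut_coords_one unfolding aut_coords_def by simp

lemma tangent_id_mono: "Z \<subseteq> Z' \<Longrightarrow> tangent_id Z \<subseteq> tangent_id Z'"
  unfolding tangent_id_def by auto

text \<open>
  A coordinate that is constant on a set has vanishing differential along it.
\<close>

lemma tangent_id_fixed_coord:
  fixes w :: "'a::field_char_0 endo \<times> 'a endo"
  assumes "w \<in> tangent_id Z" "\<And>g. g \<in> Z \<Longrightarrow> coord_of (g, inv\<^bsub>AutA2\<^esub> g) k = r"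
  shows "coord_of w k = 0"
proof -
  define P :: "'a coord_poly" where "P = Poly_Mapping.single (Poly_Mapping.single k 1) 1 + Poly_Mapping.single 0 (- r)"
  have P: "cp_eval P c = c k - r" for c
    by (simp add: P_def cp_eval_add cp_eval_single mon_eval_def)
  have "cp_diff P (coord_of id_pair) (coord_of w) = 0"
    using assms unfolding tangent_id_iff by (simp add: P)
  moreover have "cp_diff P (coord_of id_pair) (coord_of w) = coeff [:coord_of id_pair k - r, coord_of w k:] 1"
    by (rule cp_diff_curve[where c = "\<lambda>k. [:coord_of id_pair k, coord_of w k:]"]) (simp_all add: P)
  ultimately show ?thesis by simp
qed

lemma tangent_id_deg_le:
  fixes w :: "'a::field_char_0 endo \<times> 'a endo"
  assumes "w \<in> tangent_id (H \<inter> Aut_deg d)"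
  shows "pair_deg_le d w"
proof -
  have *: "coord_of (g, inv\<^bsub>AutA2\<^esub> g) (k i j) = 0" if "d < i + j" "g \<in> H \<inter> Aut_deg d" "k \<in> {FwdX, FwdY, InvX, InvY}" for g :: "'a endo" and i j k
  proof (rule ccontr)
    assume "coord_of (g, inv\<^bsub>AutA2\<^esub> g) (k i j) \<noteq> 0"
    then have "i + j \<le> d"
      using that(2,3) by (auto simp: Aut_deg_iff pair_deg_le_def deg_le_def)
    then show False using that(1) by simp
  qed
  have "i + j \<le> d" if "coord_of w (k i j) \<noteq> 0" "k \<in> {FwdX, FwdY, InvX, InvY}" for i j k
    using tangent_id_fixed_coord[OF assms *[of i j _ k]] that by (meson not_le)
  from this[of FwdX] this[of FwdY] this[of InvX] this[of InvY]
  show ?thesis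
    by (simp add: pair_deg_le_def deg_le_def)
qed

text \<open>
  Equations of a set give linear equations of its tangent space, read off along the line
  \<open>id + t w\<close>. The identity has degree one, so the line stays below the degree bound only if \<open>1 \<le> d\<close>.
\<close>

lemma tangent_id_regular:
  fixes w :: "'a::field_char_0 endo \<times> 'a endo"
  assumes w: "w \<in> tangent_id (H \<inter> Aut_deg d)" and d: "1 \<le> d"
    and f: "regular d f" "\<And>g. g \<in> H \<inter> Aut_deg d \<Longrightarrow> f (g, inv\<^bsub>AutA2\<^esub> g) = 0"
    and q: "\<And>t. poly q t = f (line w t)"
  shows "coeff q 1 = 0"
proof -
  obtain P where P: "\<And>w. pair_deg_le d w \<Longrightarrow> cp_eval P (coord_of w) = f w"
    using f(1) unfolding regular_def by blast
  obtain q' where q': "\<And>t. poly q' t = cp_eval P (coord_of (line w t))"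
    "coeff q' 1 = cp_diff P (coord_of id_pair) (coord_of w)"
    using cp_eval_along_jet[OF pair_jet_line] by blast
  have "q = q'"
    using q q' P pair_deg_le_line[OF tangent_id_deg_le[OF w] d] by (intro poly_ext) simp
  moreover have "cp_diff P (coord_of id_pair) (coord_of w) = 0"
    using w f(2) P unfolding tangent_id_iff by (auto simp: Aut_deg_iff)
  ultimately show ?thesis using q' by simp
qed

lemma tangent_id_add:
  assumes "w \<in> tangent_id Z" "w' \<in> tangent_id Z"
  shows "((fst (fst w) + fst (fst w'), snd (fst w) + snd (fst w')),
          (fst (snd w) + fst (snd w'), snd (snd w) + snd (snd w'))) \<in> tangent_id Z" (is "?s \<in> _")
proof -
  have "coord_of ?s = (\<lambda>k. coord_of w k + coord_of w' k)"
    by (rule ext, case_tac k) simp_all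
  then show ?thesis
    using assms unfolding tangent_id_iff by (simp add: linform_linear[OF linform_cp_diff])
qed

lemma tangent_id_scale:
  assumes "w \<in> tangent_id Z"
  shows "((const2 c * fst (fst w), const2 c * snd (fst w)),
          (const2 c * fst (snd w), const2 c * snd (snd w))) \<in> tangent_id Z" (is "?s \<in> _")
proof -
  have "coord_of ?s = (\<lambda>k. c * coord_of w k)"
    by (rule ext, case_tac k) simp_all
  then show ?thesis
    using assms unfolding tangent_id_iff by (simp add: linform_linear[OF linform_cp_diff])
qed

lemma zero_in_tangent_id: "((0, 0), (0, 0)) \<in> tangent_id Z"
proof -
  have "coord_of ((0, 0), (0, 0)) = (\<lambda>k. 0 :: 'a::comm_ring_1)"
    by (rule ext, case_tac k) simp_all
  then show ?thesis
    unfolding tangent_id_iff by (simp add: linform_linear[OF linform_cp_diff])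
qed

text \<open>
  Tangent spaces grow with the degree bound, so the bound may be taken as large as desired. In
  particular it can be assumed positive, and common to two vectors.
\<close>

lemma LieE:
  assumes "\<xi> \<in> Lie H"
  obtains w d where "w \<in> tangent_id (H \<inter> Aut_deg d)" "\<xi> = fst w" "1 \<le> d" "n \<le> d"
proof -
  obtain w d where w: "w \<in> tangent_id (H \<inter> Aut_deg d)" "\<xi> = fst w"
    using assms unfolding Lie_def by blast
  have "w \<in> tangent_id (H \<inter> Aut_deg (max n (Suc d)))"
    using w(1) by (rule subsetD[OF tangent_id_mono, rotated]) (intro Int_mono order_refl Aut_deg_mono, simp)
  then show ?thesis
    using w(2) by (intro that) auto
qed

lemma LieI: "w \<in> tangent_id (H \<inter> Aut_deg d) \<Longrightarrow> fst w \<in> Lie H"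
  unfolding Lie_def by blast

lemma Lie_mono: "H \<subseteq> H' \<Longrightarrow> Lie H \<subseteq> Lie H'"
  unfolding Lie_def by (intro UN_mono order_refl image_mono tangent_id_mono Int_mono)

lemma Lie_zero: "(0, 0) \<in> Lie H"
  using LieI[OF zero_in_tangent_id] by simp

lemma Lie_add:
  assumes "\<xi> \<in> Lie H" "\<eta> \<in> Lie H"
  shows "(fst \<xi> + fst \<eta>, snd \<xi> + snd \<eta>) \<in> Lie H"
proof -
  obtain w d where w: "w \<in> tangent_id (H \<inter> Aut_deg d)" "\<xi> = fst w"
    using assms(1) by (rule LieE) blast
  obtain w' d' where w': "w' \<in> tangent_id (H \<inter> Aut_deg d')" "\<eta> = fst w'" "d \<le> d'"
    using assms(2) by (rule LieE) blast
  have "w \<in> tangent_id (H \<inter> Aut_deg d')"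
    using w(1) by (rule subsetD[OF tangent_id_mono, rotated]) (intro Int_mono order_refl Aut_deg_mono w'(3))
  from LieI[OF tangent_id_add[OF this w'(1)]] show ?thesis
    using w(2) w'(2) by simp
qed

lemma Lie_scale:
  assumes "\<xi> \<in> Lie H"
  shows "(const2 c * fst \<xi>, const2 c * snd \<xi>) \<in> Lie H"
proof -
  obtain w d where w: "w \<in> tangent_id (H \<inter> Aut_deg d)" "\<xi> = fst w"
    using assms(1) by (rule LieE) blast
  from LieI[OF tangent_id_scale[OF w(1)]] show ?thesis
    using w(2) by simp
qed

section \<open>Conjugation\<close>

lemma poly_regular_subst2_left:
  assumes "poly_regular d f1" "poly_regular d f2"
  shows "poly_regular d (\<lambda>w. subst2 p (f1 w, f2 w))"
  by (induction p rule: bipoly_induct) (use assms in \<open>auto simp: subst2_simps\<close>)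

abbreviation conj_by :: "'a::comm_ring_1 endo \<Rightarrow> 'a endo \<Rightarrow> 'a endo" where
  "conj_by \<gamma> g \<equiv> \<gamma> \<otimes>\<^bsub>AutA2\<^esub> g \<otimes>\<^bsub>AutA2\<^esub> inv\<^bsub>AutA2\<^esub> \<gamma>"

lemma inv_conj_by:
  assumes "\<gamma> \<in> carrier AutA2" "g \<in> carrier AutA2"
  shows "inv\<^bsub>AutA2\<^esub> (conj_by \<gamma> g) = conj_by \<gamma> (inv\<^bsub>AutA2\<^esub> g)"
proof -
  interpret group "AutA2 :: 'a endo monoid" by (rule group_AutA2)
  show ?thesis
    using assms by (simp add: inv_mult_group m_assoc del: AutA2_mult)
qed

text \<open>
  Conjugating by a fixed automorphism is a morphism on pairs of bounded degree: the right factor is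
  substituted into the moving endomorphism, which is linear, and the result is substituted into the left
  factor, which is polynomial.
\<close>

lemma regular_conj_by:
  "regular d (\<lambda>w. cp_eval P (coord_of (conj_by \<gamma> (fst w), conj_by \<gamma> (snd w))))"
proof (rule regular_compose)
  fix k
  have *: "poly_regular d (\<lambda>w. subst2 (subst2 p (fst w)) \<delta>)" "poly_regular d (\<lambda>w. subst2 (subst2 p (snd w)) \<delta>)" for \<delta> :: "'a endo" and p :: "'a bipoly"
    unfolding subst2_assoc
    by (intro poly_regular_subst2_left poly_regular_subst2 poly_regular_component; simp add: pair_deg_le_def)+
  show "regular d (\<lambda>w. coord_of (conj_by \<gamma> (fst w), conj_by \<gamma> (snd w)) k)"
    using * by (cases k) (auto simp: poly_regular_def)
qed

lemma conj_by_Aut_deg: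
  assumes "\<gamma> \<in> Aut_deg e" "g \<in> Aut_deg d"
  shows "conj_by \<gamma> g \<in> Aut_deg (e * (d * e))"
proof -
  interpret group "AutA2 :: 'a endo monoid" by (rule group_AutA2)
  have c: "\<gamma> \<in> carrier AutA2" "g \<in> carrier AutA2"
    using assms by (auto simp: Aut_deg_iff)
  then have "conj_by \<gamma> g \<in> carrier AutA2"
    by (simp del: AutA2_mult)
  moreover have "deg_le (e * (d * e)) (subst2 (subst2 p h) (inv\<^bsub>AutA2\<^esub> \<gamma>))"
    if "deg_le e p" "h = g \<or> h = inv\<^bsub>AutA2\<^esub> g" for p h
    unfolding subst2_assoc
    using assms that by (intro deg_le_subst2) (auto simp: Aut_deg_iff pair_deg_le_def intro: deg_le_subst2)
  ultimately show ?thesis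
    unfolding Aut_deg_iff inv_conj_by[OF c]
    using assms(1) by (simp add: Aut_deg_iff pair_deg_le_def)
qed

text \<open>
  Continuity of conjugation. It raises degrees by a bounded factor, so the equations that cut out
  the set in a higher filtration step can be pulled back.
\<close>

lemma ind_closed_conj_preimage:
  assumes \<gamma>: "\<gamma> \<in> carrier AutA2" and Z: "ind_closed Z"
  shows "ind_closed {g \<in> carrier AutA2. conj_by \<gamma> g \<in> Z}"
  unfolding ind_closed_def
proof (intro conjI allI)
  fix d
  obtain e where e: "\<gamma> \<in> Aut_deg e"
    using \<gamma> max.cobounded1 max.cobounded2 unfolding Aut_deg_def by blast
  define e' where "e' = e * (d * e)"
  obtain M where M: "Z \<inter> Aut_deg e' = {g \<in> Aut_deg e'. \<forall>P\<in>M. cp_eval P (aut_coords g) = 0}"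
    using Z unfolding ind_closed_def zariski_closed_in_deg_def by blast
  have "\<exists>Q. \<forall>w. pair_deg_le d w \<longrightarrow> cp_eval Q (coord_of w) = cp_eval P (coord_of (conj_by \<gamma> (fst w), conj_by \<gamma> (snd w)))" for P
    using regular_conj_by unfolding regular_def .
  then obtain Q where Q: "\<And>P w. pair_deg_le d w \<Longrightarrow> cp_eval (Q P) (coord_of w) = cp_eval P (coord_of (conj_by \<gamma> (fst w), conj_by \<gamma> (snd w)))"
    by metis
  have pull: "cp_eval (Q P) (aut_coords g) = cp_eval P (aut_coords (conj_by \<gamma> g))" if "g \<in> Aut_deg d" for P g
    using that Q inv_conj_by[OF \<gamma>] unfolding aut_coords_def by (simp add: Aut_deg_iff del: AutA2_mult)
  \<comment> \<open>Conjugation maps \<open>Aut_deg d\<close> into \<open>Aut_deg e'\<close>, so membership in \<open>Z\<close> is tested by the equations \<open>M\<close>.\<close>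
  have "{g \<in> carrier AutA2. conj_by \<gamma> g \<in> Z} \<inter> Aut_deg d = {g \<in> Aut_deg d. conj_by \<gamma> g \<in> Z \<inter> Aut_deg e'}"
    using conj_by_Aut_deg[OF e] unfolding e'_def by (auto simp: Aut_deg_iff simp del: AutA2_mult)
  also have "\<dots> = {g \<in> Aut_deg d. \<forall>P\<in>Q ` M. cp_eval P (aut_coords g) = 0}"
    unfolding M using conj_by_Aut_deg[OF e] unfolding e'_def by (auto simp: pull simp del: AutA2_mult)
  finally show "zariski_closed_in_deg d ({g \<in> carrier AutA2. conj_by \<gamma> g \<in> Z} \<inter> Aut_deg d)"
    unfolding zariski_closed_in_deg_def by blast
qed auto

lemma subset_closure_of_generated: "generate AutA2 T \<subseteq> closure_of_generated T"
  unfolding closure_of_generated_def by (rule hull_subset)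

lemma closure_of_generated_minimal:
  "generate AutA2 T \<subseteq> Z \<Longrightarrow> ind_closed Z \<Longrightarrow> closure_of_generated T \<subseteq> Z"
  unfolding closure_of_generated_def by (rule hull_minimal)

text \<open>
  If a closed set contains the group generated by \<open>T\<close>, then so does its preimage under conjugation by an
  element of this group, and the preimage is closed as well. Invariance thus passes from the group to
  its closure.
\<close>

lemma closure_of_generated_conj:
  fixes T :: "'a::comm_ring_1 endo set"
  assumes T: "T \<subseteq> carrier AutA2" and \<gamma>: "\<gamma> \<in> generate AutA2 T" and g: "g \<in> closure_of_generated T"
  shows "conj_by \<gamma> g \<in> closure_of_generated T"
proof -
  interpret group "AutA2 :: 'a endo monoid" by (rule group_AutA2)
  have "conj_by \<gamma> g \<in> Z" if Z: "ind_closed Z" "generate AutA2 T \<subseteq> Z" for Z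
  proof -
    have "conj_by \<gamma> h \<in> generate AutA2 T" if "h \<in> generate AutA2 T" for h
      using \<gamma> that generate_m_inv_closed[OF T] by (blast intro: generate.eng)
    then have "generate AutA2 T \<subseteq> {g \<in> carrier AutA2. conj_by \<gamma> g \<in> Z}"
      using Z(2) generate_in_carrier[OF T] by blast
    then show ?thesis
      using closure_of_generated_minimal[OF _ ind_closed_conj_preimage[OF generate_in_carrier[OF T \<gamma>] Z(1)]] g by blast
  qed
  then show ?thesis
    unfolding closure_of_generated_def hull_def by blast
qed

text \<open>
  The differential of conjugation by \<open>\<gamma>\<close> is \<open>Ad \<gamma>\<close>: along the line \<open>id + t w\<close> the conjugate has the
  first-order part \<open>id + t Ad \<gamma> w\<close>, by the chain rule, and a function that vanishes on the invariant
  set pulls back to one that vanishes on it.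
\<close>

lemma tangent_id_conj:
  fixes H :: "'a::field_char_0 endo set"
  assumes \<gamma>: "\<gamma> \<in> Aut_deg e" and H: "\<And>g. g \<in> H \<Longrightarrow> conj_by \<gamma> g \<in> H"
    and w: "w \<in> tangent_id (H \<inter> Aut_deg d)" and d: "1 \<le> d"
  shows "(Ad \<gamma> (fst w), Ad \<gamma> (snd w)) \<in> tangent_id (H \<inter> Aut_deg (e * (d * e)))"
  unfolding tangent_id_iff
proof (intro allI impI)
  let ?\<delta> = "inv\<^bsub>AutA2\<^esub> \<gamma>"
  fix P :: "'a coord_poly"
  assume P: "\<forall>g\<in>H \<inter> Aut_deg (e * (d * e)). cp_eval P (coord_of (g, inv\<^bsub>AutA2\<^esub> g)) = 0"
  have \<gamma>c: "\<gamma> \<in> carrier AutA2" using \<gamma> by (simp add: Aut_deg_iff)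
  define \<phi> where "\<phi> t = (conj_by \<gamma> (fst (line w t)), conj_by \<gamma> (snd (line w t)))" for t
  have j: "jet (\<lambda>t. subst2 (subst2 p (fst (line w t))) ?\<delta>) (subst2 p ?\<delta>) (subst2 (vf_apply (fst w) p) ?\<delta>)"
    "jet (\<lambda>t. subst2 (subst2 p (snd (line w t))) ?\<delta>) (subst2 p ?\<delta>) (subst2 (vf_apply (snd w) p) ?\<delta>)" for p
    using jet_subst2_right[OF jet_subst2_left[OF jet_line[of X2 "fst (fst w)"] jet_line[of Y2 "snd (fst w)"]]]
      jet_subst2_right[OF jet_subst2_left[OF jet_line[of X2 "fst (snd w)"] jet_line[of Y2 "snd (snd w)"]]]
    unfolding line_def vf_apply_def by (simp_all only: subst2_id fst_conv snd_conv)
  have "conj_by \<gamma> (X2, Y2) = (X2, Y2)"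
    using group.r_inv[OF group_AutA2 \<gamma>c] by (simp add: subst2_id)
  then have "pair_jet \<phi> id_pair (Ad \<gamma> (fst w), Ad \<gamma> (snd w))"
    using j[of "fst \<gamma>"] j[of "snd \<gamma>"] by (simp add: pair_jet_def \<phi>_def id_pair_def Ad_def subst2_id)
  from cp_eval_along_jet[OF this, of P] obtain q where
    q: "\<And>t. poly q t = cp_eval P (coord_of (\<phi> t))"
      "coeff q 1 = cp_diff P (coord_of id_pair) (coord_of (Ad \<gamma> (fst w), Ad \<gamma> (snd w)))"
    by blast
  have "coeff q 1 = 0"
  proof (rule tangent_id_regular[OF w d])
    show "regular d (\<lambda>w. cp_eval P (coord_of (conj_by \<gamma> (fst w), conj_by \<gamma> (snd w))))"
      by (rule regular_conj_by)
    fix g assume g: "g \<in> H \<inter> Aut_deg d"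
    then have "conj_by \<gamma> g \<in> H \<inter> Aut_deg (e * (d * e))"
      using H conj_by_Aut_deg[OF \<gamma>] by blast
    with P have "cp_eval P (coord_of (conj_by \<gamma> g, inv\<^bsub>AutA2\<^esub> (conj_by \<gamma> g))) = 0"
      by blast
    then show "cp_eval P (coord_of (conj_by \<gamma> (fst (g, inv\<^bsub>AutA2\<^esub> g)), conj_by \<gamma> (snd (g, inv\<^bsub>AutA2\<^esub> g)))) = 0"
      using inv_conj_by[OF \<gamma>c, of g] g by (simp add: Aut_deg_iff del: AutA2_mult)
  qed (simp add: q \<phi>_def)
  then show "cp_diff P (coord_of id_pair) (coord_of (Ad \<gamma> (fst w), Ad \<gamma> (snd w))) = 0"
    using q by simp
qed

section \<open>One-parameter groups of shears\<close>

text \<open>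
  Both generators of the group are values of this one family. It is used with \<open>a b = 0\<close>: then the two
  shears with coefficients \<open>a\<close> and \<open>b\<close> commute, one of them being the identity, and
  \<open>t \<mapsto> shear (t a) (t b)\<close> is a one-parameter group with the infinitesimal generator \<open>shear_field a b\<close>.
\<close>

definition shear :: "'a::comm_ring_1 \<Rightarrow> 'a \<Rightarrow> 'a endo" where
  "shear a b = (X2 + const2 a * Y2 ^ 2, Y2 + const2 b * X2 ^ 2)"

definition shear_field :: "'a::comm_ring_1 \<Rightarrow> 'a \<Rightarrow> 'a vfield" where
  "shear_field a b = (const2 a * Y2 ^ 2, const2 b * X2 ^ 2)"

lemma shear_0: "shear 0 0 = \<one>\<^bsub>AutA2\<^esub>"
  by (simp add: shear_def)

lemma shear_mult:
  fixes a b :: "'a::idom"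
  assumes "a * b = 0"
  shows "shear (s * a) (s * b) \<otimes>\<^bsub>AutA2\<^esub> shear (t * a) (t * b) = shear ((s + t) * a) ((s + t) * b)"
  using assms by (auto simp: shear_def subst2_simps const2_mult const2_add algebra_simps)

lemma inv_shear:
  fixes a b :: "'a::idom"
  assumes "a * b = 0"
  shows "shear a b \<in> carrier AutA2" "inv\<^bsub>AutA2\<^esub> (shear a b) = shear (- a) (- b)"
  using shear_mult[OF assms, of 1 "- 1"] shear_mult[OF assms, of "- 1" 1]
  by (auto intro!: AutA2_inverseI simp: shear_0 simp del: AutA2_mult AutA2_one)

lemma shear_Aut_deg:
  fixes a b :: "'a::idom"
  assumes "a * b = 0"
  shows "shear a b \<in> Aut_deg 2"
proof -
  have "deg_le 2 (X2 + const2 c * Y2 ^ 2)" "deg_le 2 (Y2 + const2 c * X2 ^ 2)" for c :: 'a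
    using deg_le_power[OF deg_le_X2, of 2] deg_le_power[OF deg_le_Y2, of 2]
      deg_le_mono[OF deg_le_X2, of 2] deg_le_mono[OF deg_le_Y2, of 2]
    by (auto intro!: deg_le_intros)
  then show ?thesis
    unfolding Aut_deg_iff inv_shear(2)[OF assms]
    using inv_shear(1)[OF assms] by (simp add: pair_deg_le_def shear_def)
qed

lemma shear_multiple_in_generate:
  fixes a b :: "'a::idom"
  assumes "a * b = 0" "shear a b \<in> T"
  shows "shear (of_nat n * a) (of_nat n * b) \<in> generate AutA2 T"
proof (induction n)
  case 0
  show ?case by (simp only: of_nat_0 mult_zero_left shear_0 generate.one)
next
  case (Suc n)
  have "shear (1 * a) (1 * b) \<in> generate AutA2 T"
    using assms(2) by (simp add: generate.incl)
  from generate.eng[OF this Suc] show ?case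
    unfolding shear_mult[OF assms(1)] by (simp add: add.commute)
qed

lemma vf_apply_add: "vf_apply \<xi> (p + q) = vf_apply \<xi> p + vf_apply \<xi> q"
  and vf_apply_scale: "vf_apply \<xi> (const2 c * p) = const2 c * vf_apply \<xi> p"
  and vf_apply_X2: "vf_apply \<xi> X2 = fst \<xi>"
  and vf_apply_Y2: "vf_apply \<xi> Y2 = snd \<xi>"
  by (simp_all add: vf_apply_def dX_mult dY_mult algebra_simps)

text \<open>
  The derivative of the adjoint action along a one-parameter group is the bracket with its generator.
\<close>

lemma jet_Ad_shear:
  fixes a b :: "'a::idom"
  assumes "a * b = 0"
  shows "jet (\<lambda>t. fst (Ad (shear (t * a) (t * b)) \<xi>)) (fst \<xi>) (fst (vf_bracket \<xi> (shear_field a b)))"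
    and "jet (\<lambda>t. snd (Ad (shear (t * a) (t * b)) \<xi>)) (snd \<xi>) (snd (vf_bracket \<xi> (shear_field a b)))"
proof -
  have inv: "inv\<^bsub>AutA2\<^esub> (shear (t * a) (t * b)) = shear (t * - a) (t * - b)" for t
    using inv_shear(2)[of "t * a" "t * b"] assms by auto
  have j: "jet (\<lambda>t. subst2 p (shear (t * - a) (t * - b))) p (- vf_apply (shear_field a b) p)" for p
    using jet_subst2_left[OF jet_line[of X2 "const2 (- a) * Y2 ^ 2"] jet_line[of Y2 "const2 (- b) * X2 ^ 2"], of p]
    by (simp add: subst2_id shear_def shear_field_def vf_apply_def const2_mult const2_minus mult.assoc)
  have "jet (\<lambda>t. subst2 p (shear (t * - a) (t * - b)) + const2 t * subst2 q (shear (t * - a) (t * - b)))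
    p (q - vf_apply (shear_field a b) p)" for p q
    using jet_add[OF j[of p] jet_mult[OF jet_param[of 1] j[of q]]] by simp
  from this[of "fst \<xi>" "vf_apply \<xi> (const2 a * Y2 ^ 2)"] this[of "snd \<xi>" "vf_apply \<xi> (const2 b * X2 ^ 2)"]
  show "jet (\<lambda>t. fst (Ad (shear (t * a) (t * b)) \<xi>)) (fst \<xi>) (fst (vf_bracket \<xi> (shear_field a b)))"
    and "jet (\<lambda>t. snd (Ad (shear (t * a) (t * b)) \<xi>)) (snd \<xi>) (snd (vf_bracket \<xi> (shear_field a b)))"
    unfolding Ad_def inv
    by (simp_all add: shear_def shear_field_def vf_bracket_def const2_mult mult.assoc
          vf_apply_add vf_apply_scale vf_apply_X2 vf_apply_Y2 subst2_add subst2_mult)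
qed

text \<open>
  In characteristic zero the powers of a single shear already form a Zariski dense subset of its
  one-parameter group.
\<close>

lemma poly_zero_if_zero_on_nats:
  fixes q :: "'a::field_char_0 poly"
  assumes "\<And>n. poly q (of_nat n) = 0"
  shows "q = 0"
proof (rule ccontr)
  assume "q \<noteq> 0"
  then have "finite {x. poly q x = 0}"
    by (rule poly_roots_finite)
  then have "finite (range (of_nat :: nat \<Rightarrow> 'a))"
    by (rule rev_finite_subset) (use assms in auto)
  then show False
    using infinite_UNIV_char_0 by (simp add: finite_image_iff inj_of_nat)
qed

text \<open>
  For every natural number \<open>n\<close> the closure is invariant under conjugation by the \<open>n\<close>-th power of the
  shear. A tangent vector moved by these conjugations is therefore a family of tangent vectors, all in
  one filtration step, that is polynomial in \<open>n\<close>. A differential that vanishes on it for all \<open>n\<close> vanishes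
  on its coefficients, and the linear one is the bracket.
\<close>

lemma Lie_bracket_shear_field:
  fixes T :: "'a::field_char_0 endo set"
  assumes T: "T \<subseteq> carrier AutA2" and ab: "a * b = 0" and sh: "shear a b \<in> T"
    and \<xi>: "\<xi> \<in> Lie (closure_of_generated T)"
  shows "vf_bracket \<xi> (shear_field a b) \<in> Lie (closure_of_generated T)"
proof -
  let ?F = "closure_of_generated T"
  obtain w d where w: "w \<in> tangent_id (?F \<inter> Aut_deg d)" "\<xi> = fst w" "1 \<le> d"
    using \<xi> by (rule LieE) blast
  let ?w' = "(vf_bracket (fst w) (shear_field a b), vf_bracket (snd w) (shear_field a b))"
  define \<phi> where "\<phi> t = (Ad (shear (t * a) (t * b)) (fst w), Ad (shear (t * a) (t * b)) (snd w))" for t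
  have pj: "pair_jet \<phi> w ?w'"
    by (simp add: pair_jet_def \<phi>_def jet_Ad_shear[OF ab])
  \<comment> \<open>Shears have degree at most 2 for all \<open>n\<close>, so one filtration step holds the whole family.\<close>
  have "\<phi> (of_nat n) \<in> tangent_id (?F \<inter> Aut_deg (2 * (d * 2)))" for n
    unfolding \<phi>_def
  proof (rule tangent_id_conj[OF shear_Aut_deg _ w(1,3)])
    show "of_nat n * a * (of_nat n * b) = 0" using ab by auto
    show "conj_by (shear (of_nat n * a) (of_nat n * b)) g \<in> ?F" if "g \<in> ?F" for g
      by (rule closure_of_generated_conj[OF T shear_multiple_in_generate[OF ab sh] that])
  qed
  then have zero: "cp_diff P (coord_of id_pair) (coord_of (\<phi> (of_nat n))) = 0"
    if "\<forall>g\<in>?F \<inter> Aut_deg (2 * (d * 2)). cp_eval P (coord_of (g, inv\<^bsub>AutA2\<^esub> g)) = 0" for P n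
    using that unfolding tangent_id_iff by blast
  have "?w' \<in> tangent_id (?F \<inter> Aut_deg (2 * (d * 2)))"
    unfolding tangent_id_iff
  proof (intro allI impI)
    fix P :: "'a coord_poly"
    assume P: "\<forall>g\<in>?F \<inter> Aut_deg (2 * (d * 2)). cp_eval P (coord_of (g, inv\<^bsub>AutA2\<^esub> g)) = 0"
    obtain q where q: "\<And>t. poly q t = cp_diff P (coord_of id_pair) (coord_of (\<phi> t))"
      "coeff q 1 = cp_diff P (coord_of id_pair) (coord_of ?w')"
      using linform_along_jet[OF pj linform_cp_diff] by blast
    have "q = 0"
      by (rule poly_zero_if_zero_on_nats) (simp add: q zero[OF P])
    then show "cp_diff P (coord_of id_pair) (coord_of ?w') = 0"
      using q(2) by simp
  qed
  from LieI[OF this] show ?thesis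
    using w(2) by simp
qed

text \<open>
  The powers of the shear lie on a line through the identity. A polynomial that vanishes at these
  infinitely many points vanishes on the line, hence has zero derivative along it.
\<close>

lemma shear_field_in_Lie:
  fixes T :: "'a::field_char_0 endo set"
  assumes ab: "a * b = 0" and sh: "shear a b \<in> T"
  shows "shear_field a b \<in> Lie (closure_of_generated T)"
proof -
  let ?F = "closure_of_generated T"
  let ?w = "(shear_field a b, shear_field (- a) (- b))"
  have pt: "shear (of_nat n * a) (of_nat n * b) \<in> ?F \<inter> Aut_deg 2" for n
    using shear_multiple_in_generate[OF assms, of n] subset_closure_of_generated[of T]
      shear_Aut_deg[of "of_nat n * a" "of_nat n * b"] ab by auto
  have line: "line ?w (of_nat n) = (shear (of_nat n * a) (of_nat n * b), inv\<^bsub>AutA2\<^esub> (shear (of_nat n * a) (of_nat n * b)))" for n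
    using inv_shear(2)[of "of_nat n * a" "of_nat n * b", symmetric] ab
    by (auto simp: line_def shear_field_def shear_def const2_mult const2_minus mult.assoc)
  have "?w \<in> tangent_id (?F \<inter> Aut_deg 2)"
    unfolding tangent_id_iff
  proof (intro allI impI)
    fix P :: "'a coord_poly"
    assume P: "\<forall>g\<in>?F \<inter> Aut_deg 2. cp_eval P (coord_of (g, inv\<^bsub>AutA2\<^esub> g)) = 0"
    obtain q where q: "\<And>t. poly q t = cp_eval P (coord_of (line ?w t))"
      "coeff q 1 = cp_diff P (coord_of id_pair) (coord_of ?w)"
      using cp_eval_along_jet[OF pair_jet_line] by blast
    have "q = 0"
      by (rule poly_zero_if_zero_on_nats) (use P pt in \<open>simp add: q line\<close>)
    then show "cp_diff P (coord_of id_pair) (coord_of ?w) = 0"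
      using q(2) by simp
  qed
  from LieI[OF this] show ?thesis by simp
qed

section \<open>Hamiltonian vector fields\<close>

text \<open>
  The Hamiltonian vector field of \<open>H\<close> for the symplectic form \<open>dx \<and> dy\<close>; these are the
  divergence-free fields.
\<close>

definition ham :: "'a::idom bipoly \<Rightarrow> 'a vfield" where
  "ham H = (dY H, - dX H)"

definition poisson :: "'a::idom bipoly \<Rightarrow> 'a bipoly \<Rightarrow> 'a bipoly" where
  "poisson P Q = dY P * dX Q - dX P * dY Q"

lemma vf_bracket_ham: "vf_bracket (ham P) (ham Q) = ham (poisson P Q)"
  by (simp add: vf_bracket_def ham_def vf_apply_def poisson_def dX_mult dY_mult dX_dY_commute algebra_simps)

lemma ham_add: "ham (P + Q) = (fst (ham P) + fst (ham Q), snd (ham P) + snd (ham Q))"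
  by (simp add: ham_def)

lemma ham_scale: "ham (const2 c * P) = (const2 c * fst (ham P), const2 c * snd (ham P))"
  by (simp add: ham_def dX_mult dY_mult)

text \<open>
  The Hamiltonians of the fields in question. The weights of \<open>x\<close> and \<open>y\<close> under the cyclic group
  are 1 and 2, so \<open>dx \<and> dy\<close> is invariant, and \<open>ham H\<close> is invariant exactly if all monomials of \<open>H\<close> with
  positive degree have weight zero. The bound on the degree says that the field
  vanishes to order at least two at the origin.
\<close>

definition admissible :: "'a::comm_ring_1 bipoly \<Rightarrow> bool" where
  "admissible H \<longleftrightarrow> (\<forall>i j. coeff2 H i j \<noteq> 0 \<longrightarrow> 3 \<le> i + j \<and> 3 dvd i + 2 * j)"

lemma shear_field_ham:
  shows "shear_field 1 0 = ham (const2 (1 / 3) * Y2 ^ 3 :: 'a::field_char_0 bipoly)"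
    and "shear_field 0 1 = ham (const2 (- 1 / 3) * X2 ^ 3 :: 'a bipoly)"
proof -
  have 3: "const2 (c / 3) * (const2 3 * p) = const2 c * p" for c :: 'a and p
    by (simp flip: const2_mult mult.assoc)
  have "dY (Y2 ^ 3) = const2 3 * (Y2 ^ 2 :: 'a bipoly)" "dX (X2 ^ 3) = const2 3 * (X2 ^ 2 :: 'a bipoly)"
    "dX (Y2 ^ 3) = (0 :: 'a bipoly)" "dY (X2 ^ 3) = (0 :: 'a bipoly)"
    using dY_monom[of 0 3, where 'a='a] dX_monom[of 3 0, where 'a='a]
      dY_monom[of 3 0, where 'a='a] dX_monom[of 0 3, where 'a='a] by simp_all
  then show "shear_field 1 0 = ham (const2 (1 / 3) * Y2 ^ 3 :: 'a bipoly)"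
    "shear_field 0 1 = ham (const2 (- 1 / 3) * X2 ^ 3 :: 'a bipoly)"
    using 3[of 1] 3[of "- 1"] by (simp_all add: shear_field_def ham_def dX_mult dY_mult const2_minus)
qed

text \<open>
  Up to a factor, the brackets with \<open>y\<^sup>2 \<partial>/\<partial>x\<close> and \<open>x\<^sup>2 \<partial>/\<partial>y\<close> replace a factor \<open>x\<close> of a monomial by \<open>y\<^sup>2\<close>,
  and a factor \<open>y\<close> by \<open>x\<^sup>2\<close>. The degree goes up by one each time.
\<close>

lemma ham_bracket_shear_field:
  fixes a b :: nat
  defines "m \<equiv> X2 ^ a * Y2 ^ b :: 'a::idom bipoly"
  shows "vf_bracket (ham m) (shear_field 1 0) = ham (const2 (- of_nat a) * (X2 ^ (a - 1) * Y2 ^ (b + 2)))"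
    and "vf_bracket (ham m) (shear_field 0 1) = ham (const2 (- of_nat b) * (X2 ^ (a + 2) * Y2 ^ (b - 1)))"
proof -
  have "vf_bracket (ham m) (shear_field 1 0) = ham (- (Y2 ^ 2 * dX m))"
    "vf_bracket (ham m) (shear_field 0 1) = ham (- (X2 ^ 2 * dY m))"
    by (simp_all add: vf_bracket_def ham_def shear_field_def vf_apply_def dX_mult dY_mult dX_dY_commute power2_eq_square algebra_simps)
  moreover have "- (Y2 ^ 2 * dX m) = const2 (- of_nat a) * (X2 ^ (a - 1) * Y2 ^ (b + 2))"
    "- (X2 ^ 2 * dY m) = const2 (- of_nat b) * (X2 ^ (a + 2) * Y2 ^ (b - 1))"
    unfolding m_def dX_monom dY_monom by (simp_all only: const2_minus power_add mult_ac minus_mult_left[symmetric] minus_mult_right[symmetric])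
  ultimately show "vf_bracket (ham m) (shear_field 1 0) = ham (const2 (- of_nat a) * (X2 ^ (a - 1) * Y2 ^ (b + 2)))"
    "vf_bracket (ham m) (shear_field 0 1) = ham (const2 (- of_nat b) * (X2 ^ (a + 2) * Y2 ^ (b - 1)))"
    by simp_all
qed

text \<open>
  This is where the two generators are seen to suffice. An admissible monomial of degree at least four
  is divisible by \<open>x\<^sup>2\<close> or by \<open>y\<^sup>2\<close>; replacing this square by \<open>y\<close> or \<open>x\<close>, respectively, gives an admissible
  monomial of smaller degree, from which a bracket with a generator leads back. The coefficient that
  appears is a positive integer, up to sign, hence invertible in characteristic zero. The induction ends
  in degree three, where the only admissible monomials are \<open>x\<^sup>3\<close> and \<open>y\<^sup>3\<close>, up to scalars the
  Hamiltonians of the generators. Only brackets with the generators occur, so the argument applies to subspaces that are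
  stable under these, before they are known to be Lie algebras.
\<close>

lemma ham_generated:
  fixes L :: "'a::field_char_0 vfield set"
  assumes zero: "(0, 0) \<in> L"
    and add: "\<And>\<xi> \<eta>. \<xi> \<in> L \<Longrightarrow> \<eta> \<in> L \<Longrightarrow> (fst \<xi> + fst \<eta>, snd \<xi> + snd \<eta>) \<in> L"
    and scale: "\<And>c \<xi>. \<xi> \<in> L \<Longrightarrow> (const2 c * fst \<xi>, const2 c * snd \<xi>) \<in> L"
    and gens: "shear_field 1 0 \<in> L" "shear_field 0 1 \<in> L"
    and bracket: "\<And>\<xi>. \<xi> \<in> L \<Longrightarrow> vf_bracket \<xi> (shear_field 1 0) \<in> L"
      "\<And>\<xi>. \<xi> \<in> L \<Longrightarrow> vf_bracket \<xi> (shear_field 0 1) \<in> L"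
    and H: "admissible H"
  shows "ham H \<in> L"
proof -
  have unscale: "ham P \<in> L" if "ham (const2 c * P) \<in> L" "c \<noteq> 0" for c P
  proof -
    have "const2 (1 / c) * const2 c = 1"
      using that(2) by (simp flip: const2_mult)
    then have "const2 (1 / c) * (const2 c * P) = P"
      by (simp flip: mult.assoc)
    then show ?thesis
      using scale[OF that(1), of "1 / c"] unfolding ham_scale[symmetric] by (simp only:)
  qed
  have monom: "ham (X2 ^ a * Y2 ^ b) \<in> L" if "3 \<le> a + b" "3 dvd a + 2 * b" for a b
    using that
  proof (induction "a + b" arbitrary: a b rule: less_induct)
    case less
    consider (cubic) "a + b = 3" | (x) "4 \<le> a + b" "2 \<le> a" | (y) "4 \<le> a + b" "2 \<le> b"
      using less.prems(1) by linarith
    then show ?case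
    proof cases
      case cubic
      then have "b \<in> {0, 1, 2, 3}" "a = 3 - b" by auto
      then have "a = 0 \<and> b = 3 \<or> a = 3 \<and> b = 0"
        using less.prems(2) by auto
      then show ?thesis
        using gens unscale[of "1 / 3" "Y2 ^ 3"] unscale[of "- 1 / 3" "X2 ^ 3"] by (auto simp: shear_field_ham)
    next
      case x
      have "ham (X2 ^ (a - 2) * Y2 ^ (b + 1)) \<in> L"
      proof (rule less.hyps)
        show "a - 2 + (b + 1) < a + b" "3 \<le> a - 2 + (b + 1)"
          using x by linarith+
        have "a - 2 + 2 * (b + 1) = a + 2 * b" using x(2) by simp
        then show "3 dvd a - 2 + 2 * (b + 1)"
          using less.prems(2) by (simp only:)
      qed
      from bracket(2)[OF this] have "ham (const2 (- of_nat (b + 1)) * (X2 ^ a * Y2 ^ b)) \<in> L"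
        unfolding ham_bracket_shear_field using x(2) by (simp only: le_add_diff_inverse2 add_diff_cancel_right')
      then show ?thesis
        by (rule unscale) (simp del: of_nat_add of_nat_Suc)
    next
      case y
      have "ham (X2 ^ (a + 1) * Y2 ^ (b - 2)) \<in> L"
      proof (rule less.hyps)
        show "a + 1 + (b - 2) < a + b" "3 \<le> a + 1 + (b - 2)"
          using y by linarith+
        have "a + 1 + 2 * (b - 2) + 3 = a + 2 * b" using y(2) by simp
        then have "3 dvd a + 1 + 2 * (b - 2) + 3" using less.prems(2) by (simp only:)
        then show "3 dvd a + 1 + 2 * (b - 2)"
          by (simp only: dvd_add_triv_right_iff)
      qed
      from bracket(1)[OF this] have "ham (const2 (- of_nat (a + 1)) * (X2 ^ a * Y2 ^ b)) \<in> L"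
        unfolding ham_bracket_shear_field using y(2) by (simp only: le_add_diff_inverse2 add_diff_cancel_right')
      then show ?thesis
        by (rule unscale) (simp del: of_nat_add of_nat_Suc)
    qed
  qed
  have sum: "ham (sum f M) \<in> L" if "\<And>m. m \<in> M \<Longrightarrow> ham (f m) \<in> L" for f and M :: "(nat \<times> nat) set"
    using that
  proof (induction M rule: infinite_finite_induct)
    case (insert m M)
    then have "ham (f m) \<in> L" "ham (sum f M) \<in> L" by auto
    from add[OF this] show ?case
      using insert.hyps by (simp add: ham_add[symmetric])
  qed (use zero in \<open>simp_all add: ham_def\<close>)
  obtain d where d: "deg_le d H"
    using deg_le_exists by blast
  show ?thesis
  proof (subst bipoly_expansion[OF d], rule sum, clarify)
    fix i j
    show "ham (const2 (coeff2 H i j) * (X2 ^ i * Y2 ^ j)) \<in> L"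
    proof (cases "coeff2 H i j = 0")
      case False
      then have "ham (X2 ^ i * Y2 ^ j) \<in> L"
        using H monom by (auto simp: admissible_def)
      then show ?thesis
        unfolding ham_scale by (rule scale)
    qed (use zero in \<open>simp add: ham_def\<close>)
  qed
qed

lemma admissible_poisson:
  fixes P Q :: "'a::field_char_0 bipoly"
  assumes "admissible P" "admissible Q"
  shows "admissible (poisson P Q)"
  unfolding admissible_def
proof (intro allI impI)
  fix i j
  assume nz: "coeff2 (poisson P Q) i j \<noteq> 0"
  have prod: "3 \<le> i + j \<and> 3 dvd i + 2 * j"
    if "coeff2 (dY P * dX Q) i j \<noteq> 0" "admissible P" "admissible Q" for P Q :: "'a bipoly"
  proof -
    from that(1) obtain i1 j1 i2 j2 where *: "i = i1 + i2" "j = j1 + j2"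
      "coeff2 (dY P) i1 j1 \<noteq> 0" "coeff2 (dX Q) i2 j2 \<noteq> 0"
      by (rule coeff2_mult_nonzeroE)
    then have "coeff2 P i1 (Suc j1) \<noteq> 0" "coeff2 Q (Suc i2) j2 \<noteq> 0"
      by (auto simp: coeff2_dX coeff2_dY)
    then have PQ: "3 \<le> i1 + Suc j1" "3 dvd i1 + 2 * Suc j1" "3 \<le> Suc i2 + j2" "3 dvd Suc i2 + 2 * j2"
      using that(2,3) unfolding admissible_def by blast+
    have "i1 + 2 * Suc j1 + (Suc i2 + 2 * j2) = i + 2 * j + 3"
      unfolding *(1,2) by simp
    then have "3 dvd i + 2 * j + 3"
      using dvd_add[OF PQ(2,4)] by (simp only:)
    then have "3 dvd i + 2 * j"
      by (simp only: dvd_add_triv_right_iff)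
    then show ?thesis
      using PQ(1,3) *(1,2) by simp
  qed
  have "coeff2 (dY P * dX Q) i j \<noteq> 0 \<or> coeff2 (dY Q * dX P) i j \<noteq> 0"
    using nz by (auto simp: poisson_def mult.commute)
  then show "3 \<le> i + j \<and> 3 dvd i + 2 * j"
    using prod assms by blast
qed

lemma lie_subalgebra_admissible:
  "lie_subalgebra (ham ` {H :: 'a::field_char_0 bipoly. admissible H})"
  unfolding lie_subalgebra_def
proof (intro conjI ballI allI; (elim imageE)?; (simp only: mem_Collect_eq)?)
  show "(0, 0) \<in> ham ` {H :: 'a bipoly. admissible H}"
    by (rule image_eqI[of _ _ 0]) (simp_all add: ham_def admissible_def)
next
  fix \<xi> \<eta> :: "'a vfield" and P Q assume *: "\<xi> = ham P" "\<eta> = ham Q" "admissible P" "admissible Q"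
  then have "admissible (P + Q)" unfolding admissible_def by (auto, (metis add_0)+)
  then show "(fst (ham P) + fst (ham Q), snd (ham P) + snd (ham Q)) \<in> ham ` {H. admissible H}"
    unfolding ham_add[symmetric] by blast
next
  fix c and \<xi> :: "'a vfield" and P assume "\<xi> = ham P" "admissible P"
  then have "admissible (const2 c * P)" by (auto simp: admissible_def)
  then show "(const2 c * fst (ham P), const2 c * snd (ham P)) \<in> ham ` {H. admissible H}"
    unfolding ham_scale[symmetric] by blast
next
  fix \<xi> \<eta> :: "'a vfield" and P Q assume *: "\<xi> = ham P" "\<eta> = ham Q" "admissible P" "admissible Q"
  then show "vf_bracket (ham P) (ham Q) \<in> ham ` {H. admissible H}"
    unfolding vf_bracket_ham using admissible_poisson by blast
qed

text \<open>
  The Poincare lemma for polynomials: integrate the first component in \<open>y\<close> and then fix the part of \<open>H\<close>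
  that depends on \<open>x\<close> alone by the second component. The formulas for the coefficients show which monomials
  can occur in \<open>H\<close>.
\<close>

lemma divergence_free_ham:
  fixes \<xi> :: "'a::field_char_0 vfield"
  assumes div: "dX (fst \<xi>) + dY (snd \<xi>) = 0"
  obtains H where "\<xi> = ham H"
    "\<And>i j. coeff2 H i (Suc j) = coeff2 (fst \<xi>) i j / of_nat (Suc j)"
    "\<And>i. coeff2 H (Suc i) 0 = - coeff2 (snd \<xi>) i 0 / of_nat (Suc i)"
    "coeff2 H 0 0 = 0"
proof -
  obtain d1 d2 where d: "deg_le d1 (fst \<xi>)" "deg_le d2 (snd \<xi>)"
    using deg_le_exists by metis
  define D where "D = Suc (max d1 d2)"
  \<comment> \<open>The quotients are the antiderivative in \<open>y\<close>, and for \<open>j = 0\<close> minus the antiderivative in \<open>x\<close>.\<close>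
  define h where "h i j = (if 0 < j then coeff2 (fst \<xi>) i (j - 1) / of_nat j
    else if 0 < i then - coeff2 (snd \<xi>) (i - 1) 0 / of_nat i else 0)" for i j :: nat
  define H where "H = (\<Sum>(i, j)\<in>{..D} \<times> {..D}. const2 (h i j) * (X2 ^ i * Y2 ^ j))"
  have H: "coeff2 H i j = h i j" for i j
  proof -
    have "coeff2 H i j = (if (i, j) \<in> {..D} \<times> {..D} then h i j else 0)"
      unfolding H_def by (rule coeff2_sum_monom) simp
    also have "\<dots> = h i j"
    proof (cases "h i j = 0")
      case False
      then have "coeff2 (fst \<xi>) i (j - 1) \<noteq> 0 \<and> 0 < j \<or> coeff2 (snd \<xi>) (i - 1) 0 \<noteq> 0 \<and> 0 < i \<and> j = 0"
        by (auto simp: h_def split: if_splits)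
      then have "i + (j - 1) \<le> d1 \<and> 0 < j \<or> (i - 1) + 0 \<le> d2 \<and> 0 < i \<and> j = 0"
        using d unfolding deg_le_def by blast
      then show ?thesis by (auto simp: D_def)
    qed simp
    finally show ?thesis .
  qed
  have div': "of_nat (Suc i) * coeff2 (fst \<xi>) (Suc i) j = - (of_nat (Suc j) * coeff2 (snd \<xi>) i (Suc j))" for i j
    using arg_cong[OF div, of "\<lambda>p. coeff2 p i j"] unfolding coeff2_simps coeff2_dX coeff2_dY
    by (rule eq_neg_iff_add_eq_0[THEN iffD2])
  have "fst \<xi> = dY H"
    by (rule bipoly_eqI) (simp add: coeff2_dY H h_def del: of_nat_Suc)
  moreover have "snd \<xi> = - dX H"
  proof (rule bipoly_eqI)
    fix i j
    show "coeff2 (snd \<xi>) i j = coeff2 (- dX H) i j"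
    proof (cases j)
      case 0
      then show ?thesis by (simp add: coeff2_dX H h_def del: of_nat_Suc)
    next
      case (Suc k)
      then show ?thesis
        using div'[of i k] by (simp add: coeff2_dX H h_def del: of_nat_Suc)
    qed
  qed
  ultimately have "\<xi> = ham H"
    by (simp add: ham_def prod_eq_iff)
  then show ?thesis
    by (rule that) (simp_all add: H h_def del: of_nat_Suc)
qed

section \<open>The Jacobian determinant\<close>

definition jacobian :: "'a::idom endo \<Rightarrow> 'a bipoly" where
  "jacobian g = dX (fst g) * dY (snd g) - dY (fst g) * dX (snd g)"

lemma dX_subst2: "dX (subst2 p g) = subst2 (dX p) g * dX (fst g) + subst2 (dY p) g * dX (snd g)"
  by (induction p rule: bipoly_induct) (simp_all add: subst2_simps dX_mult dY_mult algebra_simps)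

lemma dY_subst2: "dY (subst2 p g) = subst2 (dX p) g * dY (fst g) + subst2 (dY p) g * dY (snd g)"
  by (induction p rule: bipoly_induct) (simp_all add: subst2_simps dX_mult dY_mult algebra_simps)

lemma jacobian_mult: "jacobian (g \<otimes>\<^bsub>AutA2\<^esub> h) = subst2 (jacobian g) h * jacobian h"
  by (simp add: jacobian_def dX_subst2 dY_subst2 subst2_simps algebra_simps)

text \<open>
  By the chain rule the Jacobian determinant of an automorphism, transported by its inverse, is a unit
  of \<open>k[x,y]\<close>, and the units are the constants.
\<close>

lemma jacobian_const:
  fixes g :: "'a::idom endo"
  assumes "g \<in> carrier AutA2"
  shows "\<exists>c. jacobian g = const2 c"
proof -
  interpret group "AutA2 :: 'a endo monoid" by (rule group_AutA2)
  let ?h = "inv\<^bsub>AutA2\<^esub> g"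
  have gh: "g \<otimes>\<^bsub>AutA2\<^esub> ?h = (X2, Y2)" "?h \<otimes>\<^bsub>AutA2\<^esub> g = (X2, Y2)"
    using r_inv[OF assms] l_inv[OF assms] by simp_all
  have "subst2 (jacobian g) ?h * jacobian ?h = 1"
    unfolding jacobian_mult[symmetric] gh by (simp add: jacobian_def)
  then have "subst2 (jacobian g) ?h dvd 1"
    by (metis dvd_triv_left)
  then obtain q where q: "subst2 (jacobian g) ?h = [:q:]" "q dvd 1"
    unfolding is_unit_poly_iff by blast
  from q(2) obtain b where "q = [:b:]"
    unfolding is_unit_poly_iff by blast
  with q(1) have c: "subst2 (jacobian g) ?h = const2 b"
    by (simp add: const2_def)
  have "jacobian g = subst2 (subst2 (jacobian g) ?h) g"
    using gh(2) by (simp add: subst2_assoc subst2_id)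
  then show ?thesis
    unfolding c by auto
qed

lemma jacobian_one: "g \<in> Aut_tangent_to_id \<Longrightarrow> jacobian g = 1"
proof -
  assume g: "g \<in> Aut_tangent_to_id"
  then have "g \<in> carrier AutA2" by (simp add: Aut_tangent_to_id_def)
  then obtain c where c: "jacobian g = const2 c"
    using jacobian_const by blast
  have "eval2 (p - q) z = eval2 p z - eval2 q z" for p q :: "'a bipoly" and z
    using eval2_simps(1)[of "p - q" q z] by simp
  then have "eval2 (jacobian g) (0, 0) = 1"
    using g by (simp add: jacobian_def Aut_tangent_to_id_def)
  then show ?thesis by (simp add: c)
qed

lemma jet_jacobian_line:
  "jet (\<lambda>t. jacobian (fst (line w t))) 1 (dX (fst (fst w)) + dY (snd (fst w)))"
  using jet_diff[OF
      jet_mult[OF jet_dX[OF jet_line[of X2 "fst (fst w)"]] jet_dY[OF jet_line[of Y2 "snd (fst w)"]]]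
      jet_mult[OF jet_dY[OF jet_line[of X2 "fst (fst w)"]] jet_dX[OF jet_line[of Y2 "snd (fst w)"]]]]
  by (simp add: jacobian_def line_def add.commute)

text \<open>
  The divergence is the differential of the Jacobian determinant, which is constantly 1 on the group.
\<close>

lemma Lie_Aut_tangent_to_id_divergence:
  fixes \<xi> :: "'a::field_char_0 vfield"
  assumes "\<xi> \<in> Lie Aut_tangent_to_id"
  shows "dX (fst \<xi>) + dY (snd \<xi>) = 0"
proof (rule bipoly_eqI)
  fix i j
  obtain w d where w: "w \<in> tangent_id (Aut_tangent_to_id \<inter> Aut_deg d)" "\<xi> = fst w" "1 \<le> d"
    using assms by (rule LieE) blast
  obtain c where c: "\<forall>t. poly c t = coeff2 (jacobian (fst (line w t))) i j"
    "coeff c 1 = coeff2 (dX (fst \<xi>) + dY (snd \<xi>)) i j"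
    using jet_coeff2[OF jet_jacobian_line[of w], of i j] unfolding w(2) by blast
  have "coeff (c - [:coeff2 1 i j:]) 1 = 0"
  proof (rule tangent_id_regular[OF w(1) w(3)])
    have "poly_regular d (\<lambda>w :: 'a endo \<times> 'a endo. jacobian (fst w))"
      unfolding jacobian_def by (intro poly_regular_diff poly_regular_mult poly_regular_dX poly_regular_dY poly_regular_component)
    then show "regular d (\<lambda>w :: 'a endo \<times> 'a endo. coeff2 (jacobian (fst w)) i j - coeff2 1 i j)"
      by (auto simp: poly_regular_def)
  qed (use c in \<open>auto simp: jacobian_one\<close>)
  then show "coeff2 (dX (fst \<xi>) + dY (snd \<xi>)) i j = coeff2 0 i j"
    using c(2) by simp
qed

section \<open>Automorphisms tangent to the identity and commuting with the cyclic group\<close>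

text \<open>
  The conditions on value and differential at the origin, as conditions on coordinates.
\<close>

definition id_to_first_order :: "'a::comm_ring_1 endo \<Rightarrow> bool" where
  "id_to_first_order g \<longleftrightarrow> (\<forall>i j. i + j < 2 \<longrightarrow>
     coeff2 (fst g) i j = coeff2 X2 i j \<and> coeff2 (snd g) i j = coeff2 Y2 i j)"

lemma Aut_tangent_to_id_iff: "g \<in> Aut_tangent_to_id \<longleftrightarrow> g \<in> carrier AutA2 \<and> id_to_first_order g"
proof -
  have ij: "(\<forall>i j. i + j < 2 \<longrightarrow> P i j) \<longleftrightarrow> P 0 0 \<and> P 1 0 \<and> P 0 1" for P :: "nat \<Rightarrow> nat \<Rightarrow> bool"
  proof
    assume *: "P 0 0 \<and> P 1 0 \<and> P 0 1"
    show "\<forall>i j. i + j < 2 \<longrightarrow> P i j"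
    proof (intro allI impI)
      fix i j :: nat assume "i + j < 2"
      then have "i = 0 \<and> j = 0 \<or> i = 1 \<and> j = 0 \<or> i = 0 \<and> j = 1" by linarith
      then show "P i j" using * by blast
    qed
  qed simp
  show ?thesis
    unfolding Aut_tangent_to_id_def id_to_first_order_def ij
    using coeff2_monom[of 1 0, where 'a='a] coeff2_monom[of 0 1, where 'a='a]
    by (auto simp: eval2_origin coeff2_dX coeff2_dY)
qed

text \<open>
  Invariance under the cyclic group in terms of the monomials that occur; the components of a
  commuting automorphism, and likewise of a fixed vector field, have the weights 1 and 2.
\<close>

definition graded :: "'a::comm_ring_1 bipoly \<times> 'a bipoly \<Rightarrow> bool" where
  "graded \<xi> \<longleftrightarrow> (\<forall>i j. (coeff2 (fst \<xi>) i j \<noteq> 0 \<longrightarrow> (i + 2 * j) mod 3 = 1) \<and>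
                     (coeff2 (snd \<xi>) i j \<noteq> 0 \<longrightarrow> (i + 2 * j) mod 3 = 2))"

text \<open>
  The elements of the cyclic group are those with \<open>z\<^sup>3 = 1\<close>.
\<close>

definition weighted_scaling :: "'a::comm_ring_1 \<Rightarrow> 'a endo" where
  "weighted_scaling z = (const2 z * X2, const2 (z ^ 2) * Y2)"

lemma coeff2_subst2_diag:
  "coeff2 (subst2 p (const2 a * X2, const2 b * Y2)) i j = a ^ i * b ^ j * coeff2 p i j"
proof -
  obtain d where d: "deg_le d p"
    using deg_le_exists by blast
  have "subst2 p (const2 a * X2, const2 b * Y2) =
    (\<Sum>(i, j)\<in>{(i, j). i + j \<le> d}. const2 (a ^ i * b ^ j * coeff2 p i j) * (X2 ^ i * Y2 ^ j))"
    unfolding subst2_expansion[OF d]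
    by (rule sum.cong) (auto simp: const2_mult const2_power power_mult_distrib mult_ac)
  also have "coeff2 \<dots> i j = a ^ i * b ^ j * coeff2 p i j"
    using d unfolding coeff2_sum_monom[OF finite_bounded_degree] deg_le_def by force
  finally show ?thesis .
qed

lemma weighted_scaling_carrier: "z ^ 3 = 1 \<Longrightarrow> weighted_scaling z \<in> carrier (AutA2 :: 'a::idom endo monoid)"
proof (rule AutA2_inverseI[of _ "weighted_scaling (z ^ 2)"])
  assume z: "z ^ 3 = 1"
  have "z * z ^ 2 = 1" "z ^ 2 * z = 1" "z ^ 2 * (z ^ 2) ^ 2 = 1" "(z ^ 2) ^ 2 * z ^ 2 = 1"
    using z by (metis power_mult power_mult_distrib power_one power_Suc power_Suc2 numeral_3_eq_3 numeral_2_eq_2)+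
  then show "weighted_scaling z \<otimes>\<^bsub>AutA2\<^esub> weighted_scaling (z ^ 2) = \<one>\<^bsub>AutA2\<^esub>" "weighted_scaling (z ^ 2) \<otimes>\<^bsub>AutA2\<^esub> weighted_scaling z = \<one>\<^bsub>AutA2\<^esub>"
    by (simp_all add: weighted_scaling_def subst2_simps flip: const2_mult mult.assoc)
qed

lemma exists_primitive_cube_root:
  "\<exists>z :: 'a::{alg_closed_field, field_char_0}. z ^ 3 = 1 \<and> z \<noteq> 1"
proof -
  obtain z :: 'a where "poly [:1, 1, 1:] z = 0"
    using alg_closed_imp_poly_has_root[of "[:1, 1, 1:] :: 'a poly"] by auto
  then have z: "1 + z + z * z = 0" by (simp add: algebra_simps)
  have "z ^ 3 - 1 = (z - 1) * (1 + z + z * z)"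
    by (simp add: algebra_simps power3_eq_cube)
  with z have "z ^ 3 = 1" by simp
  moreover have "z \<noteq> 1" using z by auto
  ultimately show ?thesis by blast
qed

text \<open>
  A nontrivial cube root of unity is primitive, so its powers separate residues modulo 3.
\<close>

lemma cube_root_power_eq:
  fixes z :: "'a::idom"
  assumes "z ^ 3 = 1" "z \<noteq> 1"
  shows "z ^ n = z ^ m \<longleftrightarrow> n mod 3 = m mod 3"
proof -
  have red: "z ^ n = z ^ (n mod 3)" for n
  proof -
    have "z ^ n = (z ^ 3) ^ (n div 3) * z ^ (n mod 3)"
      by (simp only: power_mult[symmetric] power_add[symmetric] mult_div_mod_eq)
    then show ?thesis using assms by simp
  qed
  have z0: "z \<noteq> 0" using assms by auto
  have z2: "z ^ 2 \<noteq> 1" "z ^ 2 \<noteq> z"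
  proof -
    have "z ^ 3 = z * z ^ 2" by (simp add: power3_eq_cube power2_eq_square)
    then show "z ^ 2 \<noteq> 1" using assms by auto
    show "z ^ 2 \<noteq> z" using assms z0 by (simp add: power2_eq_square)
  qed
  have "n mod 3 \<in> {0, 1, 2}" "m mod 3 \<in> {0, 1, 2}" by auto
  then show ?thesis
    unfolding red[of n] red[of m] using z2 assms(2) by auto
qed

text \<open>
  A primitive cube root of unity tests the weights. It exists because the field is algebraically
  closed of characteristic different from 3.
\<close>

lemma graded_iff:
  fixes \<xi> :: "'a::{alg_closed_field, field_char_0} bipoly \<times> 'a bipoly"
  shows "graded \<xi> \<longleftrightarrow> (\<forall>z. z ^ 3 = 1 \<longrightarrow>
    subst2 (fst \<xi>) (weighted_scaling z) = const2 z * fst \<xi> \<and> subst2 (snd \<xi>) (weighted_scaling z) = const2 (z ^ 2) * snd \<xi>)"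
    (is "_ \<longleftrightarrow> (\<forall>z. _ \<longrightarrow> ?eqv z)")
proof -
  have cancel: "z ^ i * (z ^ 2) ^ j * c = z ^ n * c \<longleftrightarrow> (c \<noteq> 0 \<longrightarrow> z ^ (i + 2 * j) = z ^ n)" for z c :: 'a and i j n :: nat
    by (auto simp: power_add power_mult)
  have eqv: "?eqv z \<longleftrightarrow> (\<forall>i j. (coeff2 (fst \<xi>) i j \<noteq> 0 \<longrightarrow> z ^ (i + 2 * j) = z ^ 1) \<and>
    (coeff2 (snd \<xi>) i j \<noteq> 0 \<longrightarrow> z ^ (i + 2 * j) = z ^ 2))" for z
    unfolding weighted_scaling_def bipoly_eq_iff coeff2_subst2_diag coeff2_simps(5) cancel[symmetric] by (simp only: power_one_right) blast
  show ?thesis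
  proof
    assume g: "graded \<xi>"
    show "\<forall>z. z ^ 3 = 1 \<longrightarrow> ?eqv z"
    proof (intro allI impI)
      fix z :: 'a assume z: "z ^ 3 = 1"
      show "?eqv z"
      proof (cases "z = 1")
        case False
        then show ?thesis
          using g unfolding eqv graded_def cube_root_power_eq[OF z False] by simp
      next
        case True
        then show ?thesis unfolding eqv by simp
      qed
    qed
  next
    assume *: "\<forall>z. z ^ 3 = 1 \<longrightarrow> ?eqv z"
    obtain z :: 'a where z: "z ^ 3 = 1" "z \<noteq> 1"
      using exists_primitive_cube_root by blast
    with * have "?eqv z" by blast
    then show "graded \<xi>"
      unfolding eqv graded_def cube_root_power_eq[OF z] by simp
  qed
qed

text \<open>
  Since \<open>z\<close> acts linearly, invariance under \<open>Ad\<close> is the same condition on a pair of polynomials as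
  commuting with \<open>z\<close>; compare the next lemma.
\<close>

lemma lie_fixed_weighted_scaling:
  fixes L :: "'a::{alg_closed_field, field_char_0} vfield set"
  shows "lie_fixed L {weighted_scaling z | z. z ^ 3 = 1} = {\<xi> \<in> L. graded \<xi>}"
proof -
  have "Ad (weighted_scaling z) \<xi> = \<xi> \<longleftrightarrow>
      subst2 (fst \<xi>) (weighted_scaling z) = const2 z * fst \<xi> \<and> subst2 (snd \<xi>) (weighted_scaling z) = const2 (z ^ 2) * snd \<xi>"
    if "z ^ 3 = 1" for z and \<xi> :: "'a vfield"
  proof -
    let ?s = "weighted_scaling z" and ?i = "inv\<^bsub>AutA2\<^esub> (weighted_scaling z)"
    have si: "(subst2 (fst ?s) ?i, subst2 (snd ?s) ?i) = (X2, Y2)" "(subst2 (fst ?i) ?s, subst2 (snd ?i) ?s) = (X2, Y2)"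
      using group.r_inv[OF group_AutA2 weighted_scaling_carrier[OF that]] group.l_inv[OF group_AutA2 weighted_scaling_carrier[OF that]] by simp_all
    have "subst2 p ?i = q \<longleftrightarrow> p = subst2 q ?s" for p q
      using subst2_assoc[of p ?i ?s] subst2_assoc[of q ?s ?i] unfolding si subst2_id by auto
    then show ?thesis
      by (auto simp: Ad_def prod_eq_iff weighted_scaling_def[of z] vf_apply_scale vf_apply_X2 vf_apply_Y2)
  qed
  then show ?thesis
    unfolding lie_fixed_def graded_iff by blast
qed

lemma group_fixed_weighted_scaling:
  fixes H :: "'a::{alg_closed_field, field_char_0} endo set"
  shows "group_fixed H {weighted_scaling z | z. z ^ 3 = 1} = {g \<in> H. graded g}"
proof -
  have "g \<otimes>\<^bsub>AutA2\<^esub> weighted_scaling z = weighted_scaling z \<otimes>\<^bsub>AutA2\<^esub> g \<longleftrightarrow>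
      subst2 (fst g) (weighted_scaling z) = const2 z * fst g \<and> subst2 (snd g) (weighted_scaling z) = const2 (z ^ 2) * snd g" for g and z :: 'a
    by (simp add: weighted_scaling_def subst2_simps)
  then show ?thesis
    unfolding group_fixed_def graded_iff by blast
qed

text \<open>
  Conditions on single coordinates of \<open>g\<close> do not involve the degree, so one set of equations cuts out
  the subset in every filtration step.
\<close>

lemma ind_closed_coords:
  assumes "Z = {g \<in> carrier AutA2. \<forall>(k, r)\<in>C. aut_coords g k = r}"
  shows "ind_closed Z"
  unfolding ind_closed_def
proof (intro conjI allI)
  show "Z \<subseteq> carrier AutA2" using assms by auto
  fix d
  \<comment> \<open>The coordinate polynomial \<open>k - r\<close>.\<close>
  define P :: "coord \<times> 'a \<Rightarrow> 'a coord_poly" where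
    "P = (\<lambda>(k, r). Poly_Mapping.single (Poly_Mapping.single k 1) 1 + Poly_Mapping.single 0 (- r))"
  have P: "cp_eval (P (k, r)) c = c k - r" for k r c
    by (simp add: P_def cp_eval_add cp_eval_single mon_eval_def)
  show "zariski_closed_in_deg d (Z \<inter> Aut_deg d)"
    unfolding zariski_closed_in_deg_def assms
    by (rule exI[of _ "P ` C"]) (auto simp: P Aut_deg_iff)
qed

definition graded_Aut :: "'a::idom endo set" where
  "graded_Aut = {g \<in> Aut_tangent_to_id. graded g}"

lemma ind_closed_graded_Aut: "ind_closed (graded_Aut :: 'a::idom endo set)"
proof (rule ind_closed_coords)
  show "graded_Aut = {g \<in> carrier AutA2. \<forall>(k, r)\<in>
     {(FwdX i j, coeff2 X2 i j) | i j. i + j < 2} \<union> {(FwdY i j, coeff2 Y2 i j) | i j. i + j < 2} \<union>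
     {(FwdX i j, 0) | i j. (i + 2 * j) mod 3 \<noteq> 1} \<union> {(FwdY i j, 0 :: 'a) | i j. (i + 2 * j) mod 3 \<noteq> 2}.
     aut_coords g k = r}"
  proof -
    have "(\<forall>(k, r)\<in>{(FwdX i j, c i j) | i j. Q i j}. aut_coords g k = r) \<longleftrightarrow> (\<forall>i j. Q i j \<longrightarrow> coeff2 (fst g) i j = c i j)"
      "(\<forall>(k, r)\<in>{(FwdY i j, c i j) | i j. Q i j}. aut_coords g k = r) \<longleftrightarrow> (\<forall>i j. Q i j \<longrightarrow> coeff2 (snd g) i j = c i j)"
      for g :: "'a endo" and c Q
      by (fastforce simp: aut_coords_def)+
    then show ?thesis
      unfolding graded_Aut_def Aut_tangent_to_id_iff id_to_first_order_def graded_def ball_Un by auto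
  qed
qed

lemma graded_Aut_mult:
  fixes g h :: "'a::{alg_closed_field, field_char_0} endo"
  assumes "g \<in> graded_Aut" "h \<in> graded_Aut"
  shows "g \<otimes>\<^bsub>AutA2\<^esub> h \<in> graded_Aut"
proof -
  interpret group "AutA2 :: 'a endo monoid" by (rule group_AutA2)
  have "g \<otimes>\<^bsub>AutA2\<^esub> h \<in> carrier AutA2"
    using assms by (simp add: graded_Aut_def Aut_tangent_to_id_def del: AutA2_mult)
  moreover have "subst2 (subst2 p h) s = subst2 (subst2 p s) h"
    if "subst2 (fst h) s = const2 z * fst h" "subst2 (snd h) s = const2 (z ^ 2) * snd h" "s = weighted_scaling z" for p s z
    using that by (simp add: subst2_assoc weighted_scaling_def subst2_simps)
  ultimately show ?thesis
    using assms unfolding graded_Aut_def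
    by (auto simp: Aut_tangent_to_id_def graded_iff eval2_subst2 dX_subst2 dY_subst2 subst2_simps)
qed

lemma shear_graded_Aut:
  fixes a b :: "'a::idom"
  assumes "a * b = 0"
  shows "shear a b \<in> graded_Aut"
  using inv_shear(1)[OF assms] coeff2_monom[of 1 0, where 'a='a] coeff2_monom[of 0 1, where 'a='a]
    coeff2_monom[of 2 0, where 'a='a] coeff2_monom[of 0 2, where 'a='a]
  by (auto simp: graded_Aut_def Aut_tangent_to_id_iff id_to_first_order_def graded_def shear_def split: if_splits)

text \<open>
  The group of automorphisms that are tangent to the identity and commute with the cyclic group is closed
  and contains the shears.
\<close>

lemma closure_of_shears_subset:
  fixes T :: "'a::{alg_closed_field, field_char_0} endo set"
  assumes "\<And>g. g \<in> T \<Longrightarrow> \<exists>a b. a * b = 0 \<and> g = shear a b"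
  shows "closure_of_generated T \<subseteq> graded_Aut"
proof (rule closure_of_generated_minimal[OF _ ind_closed_graded_Aut], rule subsetI)
  fix g assume "g \<in> generate AutA2 T"
  then show "g \<in> graded_Aut"
  proof induction
    case one
    show ?case unfolding shear_0[symmetric] by (rule shear_graded_Aut) simp
  next
    case (incl h)
    then show ?case using assms shear_graded_Aut by blast
  next
    case (inv h)
    then obtain a b where "a * b = 0" "h = shear a b" using assms by blast
    then show ?case using inv_shear(2)[of a b] shear_graded_Aut[of "- a" "- b"] by simp
  next
    case (eng h1 h2)
    then show ?case by (intro graded_Aut_mult)
  qed
qed

section \<open>The fixed Lie algebra\<close>

lemma Lie_graded_Aut_graded:
  fixes \<xi> :: "'a::field_char_0 vfield"
  assumes "\<xi> \<in> Lie graded_Aut"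
  shows "graded \<xi>"
proof -
  obtain w d where w: "w \<in> tangent_id (graded_Aut \<inter> Aut_deg d)" "\<xi> = fst w"
    using assms by (rule LieE) blast
  have "coord_of w (FwdX i j) = 0" if "(i + 2 * j) mod 3 \<noteq> 1" for i j
    by (rule tangent_id_fixed_coord[OF w(1)]) (use that in \<open>auto simp: graded_Aut_def graded_def\<close>)
  moreover have "coord_of w (FwdY i j) = 0" if "(i + 2 * j) mod 3 \<noteq> 2" for i j
    by (rule tangent_id_fixed_coord[OF w(1)]) (use that in \<open>auto simp: graded_Aut_def graded_def\<close>)
  ultimately show ?thesis
    unfolding w(2) graded_def by auto
qed

lemma Lie_Aut_tangent_to_id_order:
  fixes \<xi> :: "'a::field_char_0 vfield"
  assumes "\<xi> \<in> Lie Aut_tangent_to_id" "i + j < 2"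
  shows "coeff2 (fst \<xi>) i j = 0" "coeff2 (snd \<xi>) i j = 0"
proof -
  obtain w d where w: "w \<in> tangent_id (Aut_tangent_to_id \<inter> Aut_deg d)" "\<xi> = fst w"
    using assms(1) by (rule LieE) blast
  have "coord_of w (FwdX i j) = 0" "coord_of w (FwdY i j) = 0"
    by (rule tangent_id_fixed_coord[OF w(1)];
        use assms(2) in \<open>auto simp: Aut_tangent_to_id_iff id_to_first_order_def\<close>)+
  then show "coeff2 (fst \<xi>) i j = 0" "coeff2 (snd \<xi>) i j = 0"
    using w(2) by simp_all
qed

text \<open>
  The equations satisfied by a tangent vector (divergence zero, order two at the origin, the right
  weights) leave room for admissible Hamiltonians only.
\<close>

lemma graded_Lie_Aut_tangent_to_id:
  fixes \<xi> :: "'a::field_char_0 vfield"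
  assumes L: "\<xi> \<in> Lie Aut_tangent_to_id" and g: "graded \<xi>"
  shows "\<xi> \<in> ham ` {H. admissible H}"
proof -
  obtain H where H: "\<xi> = ham H"
    "\<And>i j. coeff2 H i (Suc j) = coeff2 (fst \<xi>) i j / of_nat (Suc j)"
    "\<And>i. coeff2 H (Suc i) 0 = - coeff2 (snd \<xi>) i 0 / of_nat (Suc i)"
    "coeff2 H 0 0 = 0"
    using divergence_free_ham[OF Lie_Aut_tangent_to_id_divergence[OF L]] by blast
  have "admissible H"
    unfolding admissible_def
  proof (intro allI impI)
    fix i j assume nz: "coeff2 H i j \<noteq> 0"
    consider (y) k where "j = Suc k" | (x) k where "j = 0" "i = Suc k" | (c) "i = 0" "j = 0"
      by (cases i; cases j) auto
    then show "3 \<le> i + j \<and> 3 dvd i + 2 * j"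
    proof cases
      case y
      then have "coeff2 (fst \<xi>) i k \<noteq> 0" using nz H by auto
      then have "\<not> i + k < 2" "(i + 2 * k) mod 3 = 1"
        using Lie_Aut_tangent_to_id_order[OF L] g unfolding graded_def by blast+
      moreover have "3 dvd n + 2" if "n mod 3 = 1" for n :: nat
        using that by presburger
      ultimately have "3 dvd i + 2 * k + 2" "2 \<le> i + k" by simp_all
      then show ?thesis unfolding y by simp
    next
      case x
      then have "coeff2 (snd \<xi>) k 0 \<noteq> 0" using nz H by auto
      then have "\<not> k + 0 < 2" "(k + 2 * 0) mod 3 = 2"
        using Lie_Aut_tangent_to_id_order[OF L] g unfolding graded_def by blast+
      moreover have "3 dvd Suc n" if "n mod 3 = 2" for n :: nat
        using that by presburger
      ultimately show ?thesis unfolding x by simp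
    qed (use nz H in auto)
  qed
  then show ?thesis using H(1) by blast
qed

theorem lemma6p2p1:
  fixes u v :: "'a::{alg_closed_field, field_char_0} endo"
    and U V F A S :: "'a endo set"
  assumes u: "u = (X2 + Y2 ^ 2, Y2)"
    and v: "v = (X2, Y2 + X2 ^ 2)"
    and U: "U = closure_of_generated {u}"
    and V: "V = closure_of_generated {v}"
    and F: "F = closure_of_generated {u, v}"
    and A: "A = Aut_tangent_to_id"
    and S: "S = {(const2 \<zeta> * X2, const2 (\<zeta> ^ 2) * Y2) | \<zeta>. \<zeta> ^ 3 = 1}"
  shows "lie_fixed (Lie A) S = lie_generated (Lie U \<union> Lie V) \<and>
         Lie F = Lie (group_fixed A S) \<and>
         Lie (group_fixed A S) = lie_fixed (Lie A) S"
proof -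
  let ?W = "ham ` {H :: 'a bipoly. admissible H}"
  have uv: "u = shear 1 0" "v = shear 0 1"
    by (simp_all add: u v shear_def)
  have S': "S = {weighted_scaling z | z. z ^ 3 = 1}"
    by (simp add: S weighted_scaling_def)
  have AS: "group_fixed A S = graded_Aut"
    by (simp add: A S' group_fixed_weighted_scaling graded_Aut_def)
  have LAS: "lie_fixed (Lie A) S = {\<xi> \<in> Lie A. graded \<xi>}"
    by (simp add: S' lie_fixed_weighted_scaling)
  have "Lie graded_Aut \<subseteq> Lie A"
    by (rule Lie_mono) (auto simp: graded_Aut_def A)
  then have AS_fixed: "Lie graded_Aut \<subseteq> lie_fixed (Lie A) S"
    unfolding LAS using Lie_graded_Aut_graded by blast
  have fixed_W: "lie_fixed (Lie A) S \<subseteq> ?W"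
    unfolding LAS using graded_Lie_Aut_tangent_to_id A by blast
  have sub: "Lie U \<subseteq> Lie graded_Aut" "Lie V \<subseteq> Lie graded_Aut" "Lie F \<subseteq> Lie graded_Aut"
    unfolding U V F uv
    by (intro Lie_mono closure_of_shears_subset; force)+
  have car: "{u, v} \<subseteq> carrier AutA2"
    unfolding uv using inv_shear(1)[of 1 "0 :: 'a"] inv_shear(1)[of 0 "1 :: 'a"] by simp
  have gens: "shear_field 1 0 \<in> Lie U" "shear_field 0 1 \<in> Lie V" "shear_field 1 0 \<in> Lie F" "shear_field 0 1 \<in> Lie F"
    unfolding U V F uv by (intro shear_field_in_Lie; simp)+
  have W_F: "?W \<subseteq> Lie F"
  proof (rule image_subsetI, simp only: mem_Collect_eq)
    fix H :: "'a bipoly" assume "admissible H"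
    show "ham H \<in> Lie F"
    proof (rule ham_generated)
      show "vf_bracket \<xi> (shear_field 1 0) \<in> Lie F" "vf_bracket \<xi> (shear_field 0 1) \<in> Lie F" if "\<xi> \<in> Lie F" for \<xi>
        using that car unfolding F uv by (intro Lie_bracket_shear_field; simp)+
    qed (use gens \<open>admissible H\<close> in \<open>auto intro: Lie_zero Lie_add Lie_scale\<close>)
  qed
  have sa: "lie_subalgebra (lie_generated (Lie U \<union> Lie V))"
    unfolding lie_generated_def by (rule hull_in) (auto simp: lie_subalgebra_def)
  have W_gen: "?W \<subseteq> lie_generated (Lie U \<union> Lie V)"
  proof (rule image_subsetI, simp only: mem_Collect_eq)
    fix H :: "'a bipoly" assume "admissible H"
    have g: "shear_field 1 0 \<in> lie_generated (Lie U \<union> Lie V)" "shear_field 0 1 \<in> lie_generated (Lie U \<union> Lie V)"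
      using gens(1,2) unfolding lie_generated_def by (auto intro: hull_inc)
    show "ham H \<in> lie_generated (Lie U \<union> Lie V)"
    proof (rule ham_generated)
    qed (use sa g \<open>admissible H\<close> in \<open>auto simp: lie_subalgebra_def\<close>)
  qed
  have gen_W: "lie_generated (Lie U \<union> Lie V) \<subseteq> ?W"
    unfolding lie_generated_def
    using sub AS_fixed fixed_W by (intro hull_minimal lie_subalgebra_admissible) blast
  have "Lie F = ?W" "Lie graded_Aut = ?W" "lie_fixed (Lie A) S = ?W"
    using AS_fixed fixed_W sub(3) W_F by simp_all
  moreover have "lie_generated (Lie U \<union> Lie V) = ?W"
    using gen_W W_gen by (rule subset_antisym)
  ultimately show ?thesis
    unfolding AS by simp
qed

end
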